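(* Suppose that $(x_j)_{j\in\mathbb{Z}}$ is a fixed Riesz-basis sequence, and for $\lambda>0$ let $I_\lambda$ be the associated Gaussian interpolation operator. Then $\{I_\lambda:0<\lambda\le1\}$ is a uniformly bounded family of linear operators from $PW_\pi$ to $L_2(\mathbb{R})$.
   Context: $\mathcal{F}$ denotes the Fourier transform on $L_2(\mathbb{R})$, i.e. the bounded linear operator on $L_2(\mathbb{R})$ with $\mathcal{F}[g](x)=\int_{-\infty}^{\infty} g(t)e^{-ixt}\,dt$ for $g\in L_1(\mathbb{R})\cap L_2(\mathbb{R})$. $PW_\pi:=\{g\in L_2(\mathbb{R}):\mathcal{F}[g]=0 \text{ a.e. outside } [-\pi,\pi]\}$, with the $L_2(\mathbb{R})$ norm. Every $g\in PW_\pi$ is taken to be its continuous representative, so that $g(t)=\frac1{2\pi}\int_{-\pi}^{\pi}\mathcal{F}[g](x)e^{ixt}\,dx$ for every $t\in\mathbb{R}$. A real sequence $(x_j)_{j\in\mathbb{Z}}$ is a Riesz-basis sequence if $x_j<x_{j+1}$ for all $j\in\mathbb{Z}$ and the functions $e_j(t):=e^{-ix_jt}$, $j\in\mathbb{Z}$, form a Riesz basis for $L_2[-\pi,\pi]$; i.e. every $h\in L_2[-\pi,\pi]$ has a unique representation $h=\sum_j a_je_j$ with $\sum_j|a_j|^2<\infty$, and there is a constant $B$ such that $B^{-1}(\sum|c_j|^2)^{1/2}\le\|\sum c_je_j\|_{L_2[-\pi,\pi]}\le B(\sum|c_j|^2)^{1/2}$ for every square-summable $(c_j)$. Gaussian interpolation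 operator: for $\lambda>0$ and $f\in PW_\pi$, there is a unique square-summable sequence $(a(j,\lambda))_{j\in\mathbb{Z}}$ with $\sum_{j}a(j,\lambda)e^{-\lambda(x_k-x_j)^2}=f(x_k)$ for all $k\in\mathbb{Z}$; $I_\lambda(f)(x):=\sum_{j\in\mathbb{Z}}a(j,\lambda)e^{-\lambda(x-x_j)^2}$, $x\in\mathbb{R}$. *)

theory Defs
  imports "HOL-Analysis.Analysis"
begin

text \<open>
  Elements of \<open>L\<^sub>2\<close> are represented by functions, so equality in \<open>L\<^sub>2\<close> is equality almost
  everywhere.  Scalars are complex throughout.
\<close>

definition L2 :: "real measure \<Rightarrow> (real \<Rightarrow> complex) set" where
  "L2 M = {f \<in> borel_measurable M. integrable M (\<lambda>t. (cmod (f t))\<^sup>2)}"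

definition L2_norm :: "real measure \<Rightarrow> (real \<Rightarrow> complex) \<Rightarrow> real" where
  "L2_norm M f = sqrt (\<integral>t. (cmod (f t))\<^sup>2 \<partial>M)"

abbreviation L2_R :: "(real \<Rightarrow> complex) set" where
  "L2_R \<equiv> L2 lborel"

abbreviation norm_R :: "(real \<Rightarrow> complex) \<Rightarrow> real" where
  "norm_R \<equiv> L2_norm lborel"

abbreviation pi_interval :: "real measure" where
  "pi_interval \<equiv> restrict_space lborel {-pi..pi}"

definition linear_operator_into_L2 ::
  "(real \<Rightarrow> complex) set \<Rightarrow> ((real \<Rightarrow> complex) \<Rightarrow> (real \<Rightarrow> complex)) \<Rightarrow> bool" where
  "linear_operator_into_L2 V T \<longleftrightarrow>
     (\<forall>f\<in>V. T f \<in> L2_R) \<and>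
     (\<forall>f\<in>V. \<forall>g\<in>V. \<forall>a b. AE x in lborel. T (\<lambda>t. a * f t + b * g t) x = a * T f x + b * T g x)"

definition fourier_integral :: "(real \<Rightarrow> complex) \<Rightarrow> real \<Rightarrow> complex" where
  "fourier_integral g x = (\<integral>t. g t * exp (- \<i> * complex_of_real (x * t)) \<partial>lborel)"

definition is_fourier_transform :: "((real \<Rightarrow> complex) \<Rightarrow> (real \<Rightarrow> complex)) \<Rightarrow> bool" where
  "is_fourier_transform F \<longleftrightarrow>
     linear_operator_into_L2 L2_R F \<and>
     (\<exists>C. \<forall>g\<in>L2_R. norm_R (F g) \<le> C * norm_R g) \<and>
     (\<forall>g\<in>L2_R. integrable lborel g \<longrightarrow> (AE x in lborel. F g x = fourier_integral g x))"

text \<open>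
  The operator on \<open>L\<^sub>2(\<real>)\<close> singled out by \<open>is_fourier_transform\<close> exists by Plancherel's theorem
  and, since \<open>L\<^sub>1 \<inter> L\<^sub>2\<close> is dense in \<open>L\<^sub>2\<close>, is unique up to the choice of representatives of
  its values.  Hence the condition below does not depend on which \<open>F\<close> is chosen.
  Continuity selects the continuous representative of each element of the space.
\<close>

definition PW_pi :: "(real \<Rightarrow> complex) set" where
  "PW_pi = {g \<in> L2_R. continuous_on UNIV g \<and>
     (\<exists>F. is_fourier_transform F \<and> (AE x in lborel. x \<notin> {-pi..pi} \<longrightarrow> F g x = 0))}"

definition square_summable :: "(int \<Rightarrow> complex) \<Rightarrow> bool" where
  "square_summable a \<longleftrightarrow> (\<lambda>j. (cmod (a j))\<^sup>2) summable_on UNIV"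

definition l2_norm :: "(int \<Rightarrow> complex) \<Rightarrow> real" where
  "l2_norm a = sqrt (\<Sum>\<^sub>\<infinity>j. (cmod (a j))\<^sup>2)"

text \<open>
  Series of functions are summed unconditionally (along finite sets of indices), in the \<open>L\<^sub>2\<close> norm.
\<close>

definition has_L2_sum ::
  "real measure \<Rightarrow> (int \<Rightarrow> real \<Rightarrow> complex) \<Rightarrow> (real \<Rightarrow> complex) \<Rightarrow> bool" where
  "has_L2_sum M u h \<longleftrightarrow> h \<in> L2 M \<and>
     ((\<lambda>J. L2_norm M (\<lambda>t. h t - (\<Sum>j\<in>J. u j t))) \<longlongrightarrow> 0) (finite_subsets_at_top UNIV)"

definition riesz_basis :: "real measure \<Rightarrow> (int \<Rightarrow> real \<Rightarrow> complex) \<Rightarrow> bool" where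
  "riesz_basis M e \<longleftrightarrow>
     (\<forall>j. e j \<in> L2 M) \<and>
     (\<forall>h\<in>L2 M. \<exists>!a. square_summable a \<and> has_L2_sum M (\<lambda>j t. a j * e j t) h) \<and>
     (\<exists>B>0. \<forall>c. square_summable c \<longrightarrow>
        (\<exists>h. has_L2_sum M (\<lambda>j t. c j * e j t) h \<and>
             inverse B * l2_norm c \<le> L2_norm M h \<and> L2_norm M h \<le> B * l2_norm c))"

definition riesz_basis_sequence :: "(int \<Rightarrow> real) \<Rightarrow> bool" where
  "riesz_basis_sequence x \<longleftrightarrow>
     (\<forall>j. x j < x (j + 1)) \<and>
     riesz_basis pi_interval (\<lambda>j t. exp (- \<i> * complex_of_real (x j * t)))"

definition interpolation_coeffs ::
  "(int \<Rightarrow> real) \<Rightarrow> real \<Rightarrow> (real \<Rightarrow> complex) \<Rightarrow> int \<Rightarrow> complex" where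
  "interpolation_coeffs x \<mu> f = (THE a. square_summable a \<and>
     (\<forall>k. ((\<lambda>j. a j * complex_of_real (exp (- \<mu> * (x k - x j)\<^sup>2))) has_sum f (x k)) UNIV))"

definition gaussian_interpolation ::
  "(int \<Rightarrow> real) \<Rightarrow> real \<Rightarrow> (real \<Rightarrow> complex) \<Rightarrow> real \<Rightarrow> complex" where
  "gaussian_interpolation x \<mu> f t =
     (\<Sum>\<^sub>\<infinity>j. interpolation_coeffs x \<mu> f j * complex_of_real (exp (- \<mu> * (t - x j)\<^sup>2)))"

end

theory Submission
  imports Defs "HOL-Probability.Characteristic_Functions" "HOL-Real_Asymp.Real_Asymp"
begin

text \<open>
  Let \<open>G\<close> be the Gaussian density with \<open>exp (- \<mu> t\<^sup>2) = \<integral> G(u) e\<^sup>i\<^sup>u\<^sup>t du\<close> and, for a finitely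
  supported sequence \<open>a\<close>, let \<open>\<psi>\<^sub>a = \<Sum> a\<^sub>j e\<^sub>j\<close>.  The quadratic form of the interpolation matrix is
  \<open>\<integral> G \<psi>\<^sub>a \<psi>\<^sub>b\<^sup>*\<close>.  Shifting the frequency only multiplies the coefficients by unimodular numbers,
  so the Riesz bounds hold on every window of length \<open>2 pi\<close>.  Hence the form is coercive with constant
  \<open>G(pi) / B\<^sup>2\<close>, which gives existence and uniqueness of the coefficients; and for \<open>\<mu> \<le> 1\<close> the part
  of the form outside \<open>[-pi, pi]\<close> is at most a multiple, independent of \<open>\<mu>\<close>, of \<open>G(pi)\<close>.  The samples
  \<open>y\<close> of \<open>f\<close> control \<open>G(pi) \<parallel>a\<parallel>\<close> by coercivity, hence the outer part, hence by duality with the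
  Riesz basis also \<open>G \<psi>\<^sub>a\<close> on \<open>[-pi, pi]\<close>, all uniformly in \<open>\<mu>\<close>.  The interpolant is the inverse
  Fourier transform of \<open>G \<psi>\<^sub>a\<close>.
\<close>

section \<open>Square-integrable functions\<close>

text \<open>The obstacle is that coercivity degenerates: \<open>freq_weight \<mu> pi\<close> tends
  to 0 with \<mu>, so coercivity alone gives no uniform bound on the coefficients. The product
  \<open>freq_weight \<mu> pi * fin_norm J a\<close> does stay bounded, and the frequencies outside
  [-pi, pi] are measured in exactly this product. Uniform estimates are made for finite sums whose
  coefficients are truncations of the exact solution. Tested against any finite sequence, these
  satisfy the equations with an arbitrarily small loss, which is all that the stability estimate
  asks for, and Fatou's lemma then passes to the full series. In this way exponential sums on the
  whole line stay finite. On the Paley--Wiener side, membership only provides some abstract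
  operator, possibly a different one for each function. A norm bound with a universal constant and
  the inversion formula therefore have to be extracted from its values on integrable
  functions.\<close>

lemma L2_measurable: "f \<in> L2 M \<Longrightarrow> f \<in> borel_measurable M"
  and L2_integrable: "f \<in> L2 M \<Longrightarrow> integrable M (\<lambda>t. (cmod (f t))\<^sup>2)"
  by (auto simp: L2_def)

lemma L2_norm_nonneg [simp]: "0 \<le> L2_norm M f"
  by (simp add: L2_norm_def)

lemma L2_norm_power2: "(L2_norm M f)\<^sup>2 = (\<integral>t. (cmod (f t))\<^sup>2 \<partial>M)"
  by (simp add: L2_norm_def)

lemma L2_bounded_mult:
  assumes f: "f \<in> L2 M" and g: "g \<in> borel_measurable M" and bd: "\<And>t. cmod (g t) \<le> K"
  shows "(\<lambda>t. g t * f t) \<in> L2 M"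
proof -
  note [measurable] = L2_measurable[OF f] g
  have "integrable M (\<lambda>t. (cmod (g t * f t))\<^sup>2)"
  proof (rule Bochner_Integration.integrable_bound)
    show "integrable M (\<lambda>t. K\<^sup>2 * (cmod (f t))\<^sup>2)"
      using L2_integrable[OF f] by simp
    show "AE t in M. norm ((cmod (g t * f t))\<^sup>2) \<le> norm (K\<^sup>2 * (cmod (f t))\<^sup>2)"
      using bd by (intro AE_I2) (auto simp: norm_mult power_mult_distrib intro!: mult_right_mono power_mono)
  qed measurable
  then show ?thesis by (simp add: L2_def)
qed

lemma L2_scale: "f \<in> L2 M \<Longrightarrow> (\<lambda>t. c * f t) \<in> L2 M"
  by (rule L2_bounded_mult[where K="cmod c"]) auto

lemma L2_cnj: "f \<in> L2 M \<Longrightarrow> (\<lambda>t. cnj (f t)) \<in> L2 M"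
  by (auto simp: L2_def intro!: measurable_compose[OF _ borel_measurable_continuous_onI, of _ _ cnj] continuous_intros)

lemma L2_norm_cnj: "L2_norm M (\<lambda>t. cnj (f t)) = L2_norm M f"
  by (simp add: L2_norm_def)

lemma abs_mult_le_add_squares: "\<bar>a * b\<bar> \<le> a\<^sup>2 + b\<^sup>2" for a b :: real
proof -
  have "0 \<le> \<bar>a\<bar> * \<bar>b\<bar>" by simp
  then show ?thesis using sum_squares_bound[of "\<bar>a\<bar>" "\<bar>b\<bar>"] unfolding abs_mult power2_abs by linarith
qed

lemma L2_mult_integrable:
  assumes f: "f \<in> L2 M" and g: "g \<in> L2 M"
  shows "integrable M (\<lambda>t. f t * g t)"
proof (rule Bochner_Integration.integrable_bound)
  note [measurable] = L2_measurable[OF f] L2_measurable[OF g]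
  show "(\<lambda>t. f t * g t) \<in> borel_measurable M" by measurable
  show "integrable M (\<lambda>t. (cmod (f t))\<^sup>2 + (cmod (g t))\<^sup>2)"
    using f g by (intro Bochner_Integration.integrable_add L2_integrable)
  show "AE t in M. norm (f t * g t) \<le> norm ((cmod (f t))\<^sup>2 + (cmod (g t))\<^sup>2)"
    using abs_mult_le_add_squares[of "cmod (f _)" "cmod (g _)"] by (simp add: norm_mult)
qed

lemma L2_add:
  assumes f: "f \<in> L2 M" and g: "g \<in> L2 M"
  shows "(\<lambda>t. f t + g t) \<in> L2 M"
proof -
  note [measurable] = L2_measurable[OF f] L2_measurable[OF g]
  have "integrable M (\<lambda>t. (cmod (f t + g t))\<^sup>2)"
  proof (rule Bochner_Integration.integrable_bound)
    show "integrable M (\<lambda>t. 2 * (cmod (f t))\<^sup>2 + 2 * (cmod (g t))\<^sup>2)"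
      using f g by (intro Bochner_Integration.integrable_add integrable_mult_right L2_integrable)
    have "(cmod (f t + g t))\<^sup>2 \<le> 2 * (cmod (f t))\<^sup>2 + 2 * (cmod (g t))\<^sup>2" for t
    proof -
      have "(cmod (f t + g t))\<^sup>2 \<le> (cmod (f t) + cmod (g t))\<^sup>2"
        by (intro power_mono norm_triangle_ineq) auto
      also have "\<dots> \<le> 2 * (cmod (f t))\<^sup>2 + 2 * (cmod (g t))\<^sup>2"
        using sum_squares_bound[of "cmod (f t)" "cmod (g t)"] by (simp add: power2_sum)
      finally show ?thesis .
    qed
    then show "AE t in M. norm ((cmod (f t + g t))\<^sup>2) \<le> norm (2 * (cmod (f t))\<^sup>2 + 2 * (cmod (g t))\<^sup>2)"
      by auto
  qed measurable
  then show ?thesis by (simp add: L2_def)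
qed

lemma L2_diff: "f \<in> L2 M \<Longrightarrow> g \<in> L2 M \<Longrightarrow> (\<lambda>t. f t - g t) \<in> L2 M"
  using L2_add[of f M "\<lambda>t. - 1 * g t"] L2_scale[of g M "- 1"] by simp

lemma L2_sum: "(\<And>j. j \<in> J \<Longrightarrow> u j \<in> L2 M) \<Longrightarrow> (\<lambda>t. \<Sum>j\<in>J. u j t) \<in> L2 M"
proof (induction J rule: infinite_finite_induct)
  case (insert i J)
  then show ?case using L2_add[of "u i" M "\<lambda>t. \<Sum>j\<in>J. u j t"] by simp
qed (auto simp: L2_def)

lemma L2_Cauchy_Schwarz_real:
  fixes f g :: "'a \<Rightarrow> real"
  assumes [measurable]: "f \<in> borel_measurable M" "g \<in> borel_measurable M"
    and f: "integrable M (\<lambda>t. (f t)\<^sup>2)" and g: "integrable M (\<lambda>t. (g t)\<^sup>2)"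
  shows "(\<integral>t. \<bar>f t * g t\<bar> \<partial>M) \<le> sqrt (\<integral>t. (f t)\<^sup>2 \<partial>M) * sqrt (\<integral>t. (g t)\<^sup>2 \<partial>M)"
proof -
  have int: "integrable M (\<lambda>t. \<bar>f t * g t\<bar>)"
  proof (rule Bochner_Integration.integrable_bound)
    show "integrable M (\<lambda>t. (f t)\<^sup>2 + (g t)\<^sup>2)" using f g by simp
    show "AE t in M. norm \<bar>f t * g t\<bar> \<le> norm ((f t)\<^sup>2 + (g t)\<^sup>2)"
      using abs_mult_le_add_squares[of "f _" "g _"] by simp
  qed measurable
  have "(\<integral>\<^sup>+t. ennreal \<bar>f t\<bar> * ennreal \<bar>g t\<bar> \<partial>M)\<^sup>2 \<le>
      (\<integral>\<^sup>+t. (ennreal \<bar>f t\<bar>)\<^sup>2 \<partial>M) * (\<integral>\<^sup>+t. (ennreal \<bar>g t\<bar>)\<^sup>2 \<partial>M)"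
    by (rule Cauchy_Schwarz_nn_integral) auto
  also have "(\<integral>\<^sup>+t. ennreal \<bar>f t\<bar> * ennreal \<bar>g t\<bar> \<partial>M) = ennreal (\<integral>t. \<bar>f t * g t\<bar> \<partial>M)"
    using int by (subst nn_integral_eq_integral[symmetric]) (auto simp: abs_mult ennreal_mult)
  also have "(\<integral>\<^sup>+t. (ennreal \<bar>f t\<bar>)\<^sup>2 \<partial>M) = ennreal (\<integral>t. (f t)\<^sup>2 \<partial>M)"
    using f by (subst nn_integral_eq_integral[symmetric]) (auto simp: ennreal_power)
  also have "(\<integral>\<^sup>+t. (ennreal \<bar>g t\<bar>)\<^sup>2 \<partial>M) = ennreal (\<integral>t. (g t)\<^sup>2 \<partial>M)"
    using g by (subst nn_integral_eq_integral[symmetric]) (auto simp: ennreal_power)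
  finally have "(\<integral>t. \<bar>f t * g t\<bar> \<partial>M)\<^sup>2 \<le> (\<integral>t. (f t)\<^sup>2 \<partial>M) * (\<integral>t. (g t)\<^sup>2 \<partial>M)"
    by (simp add: ennreal_power flip: ennreal_mult)
  then have "(\<integral>t. \<bar>f t * g t\<bar> \<partial>M) \<le> sqrt ((\<integral>t. (f t)\<^sup>2 \<partial>M) * (\<integral>t. (g t)\<^sup>2 \<partial>M))"
    by (rule real_le_rsqrt)
  then show ?thesis by (simp add: real_sqrt_mult)
qed

lemma L2_Cauchy_Schwarz:
  assumes f: "f \<in> L2 M" and g: "g \<in> L2 M"
  shows "cmod (\<integral>t. f t * g t \<partial>M) \<le> L2_norm M f * L2_norm M g"
proof -
  note [measurable] = L2_measurable[OF f] L2_measurable[OF g]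
  have "cmod (\<integral>t. f t * g t \<partial>M) \<le> (\<integral>t. \<bar>cmod (f t) * cmod (g t)\<bar> \<partial>M)"
    using integral_norm_bound[of M "\<lambda>t. f t * g t"] by (simp add: norm_mult)
  also have "\<dots> \<le> L2_norm M f * L2_norm M g"
    unfolding L2_norm_def by (rule L2_Cauchy_Schwarz_real) (auto intro: L2_integrable f g)
  finally show ?thesis .
qed

lemma L2_norm_triangle:
  assumes f: "f \<in> L2 M" and g: "g \<in> L2 M"
  shows "L2_norm M (\<lambda>t. f t + g t) \<le> L2_norm M f + L2_norm M g"
proof (rule power2_le_imp_le)
  note [measurable] = L2_measurable[OF f] L2_measurable[OF g]
  have cs: "(\<integral>t. \<bar>cmod (f t) * cmod (g t)\<bar> \<partial>M) \<le> L2_norm M f * L2_norm M g"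
    unfolding L2_norm_def by (rule L2_Cauchy_Schwarz_real) (auto intro: L2_integrable f g)
  have int: "integrable M (\<lambda>t. \<bar>cmod (f t) * cmod (g t)\<bar>)"
    using integrable_norm[OF L2_mult_integrable[OF f g]] by (simp add: norm_mult)
  have "(L2_norm M (\<lambda>t. f t + g t))\<^sup>2 \<le>
      (\<integral>t. (cmod (f t))\<^sup>2 + (cmod (g t))\<^sup>2 + 2 * \<bar>cmod (f t) * cmod (g t)\<bar> \<partial>M)"
    unfolding L2_norm_power2
  proof (rule integral_mono)
    fix t
    have "(cmod (f t + g t))\<^sup>2 \<le> (cmod (f t) + cmod (g t))\<^sup>2"
      by (intro power_mono norm_triangle_ineq) auto
    then show "(cmod (f t + g t))\<^sup>2 \<le> (cmod (f t))\<^sup>2 + (cmod (g t))\<^sup>2 + 2 * \<bar>cmod (f t) * cmod (g t)\<bar>"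
      by (simp add: power2_sum)
  qed (use int L2_integrable[OF f] L2_integrable[OF g] L2_integrable[OF L2_add[OF f g]] in auto)
  also have "\<dots> = (L2_norm M f)\<^sup>2 + (L2_norm M g)\<^sup>2 + 2 * (\<integral>t. \<bar>cmod (f t) * cmod (g t)\<bar> \<partial>M)"
    using int L2_integrable[OF f] L2_integrable[OF g] by (simp add: L2_norm_power2)
  also have "\<dots> \<le> (L2_norm M f + L2_norm M g)\<^sup>2"
    using cs by (simp add: power2_sum)
  finally show "(L2_norm M (\<lambda>t. f t + g t))\<^sup>2 \<le> (L2_norm M f + L2_norm M g)\<^sup>2" .
qed auto

lemma L2_norm_minus_commute: "L2_norm M (\<lambda>t. f t - g t) = L2_norm M (\<lambda>t. g t - f t)"
  by (simp add: L2_norm_def norm_minus_commute)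

lemma L2_norm_le_add_diff:
  assumes f: "f \<in> L2 M" and g: "g \<in> L2 M"
  shows "L2_norm M f \<le> L2_norm M g + L2_norm M (\<lambda>t. f t - g t)"
  using L2_norm_triangle[OF g L2_diff[OF f g]] by simp

lemma L2_norm_cong_AE:
  assumes "f \<in> borel_measurable M" "g \<in> borel_measurable M" "AE t in M. f t = g t"
  shows "L2_norm M f = L2_norm M g"
proof -
  note [measurable] = assms(1,2)
  show ?thesis unfolding L2_norm_def
    by (rule arg_cong[where f=sqrt], rule integral_cong_AE) (use assms(3) in auto)
qed

section \<open>Gaussians and the Fourier integral\<close>

text \<open>The substitution v = c u with c = sqrt (2 s) reduces it to the characteristic function
  of the standard normal distribution.\<close>

lemma Gaussian_fourier:
  fixes s t :: real
  assumes s: "s > 0"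
  shows "has_bochner_integral lborel
    (\<lambda>u. complex_of_real (exp (- s * u\<^sup>2)) * exp (\<i> * complex_of_real (u * t)))
    (complex_of_real (sqrt (pi / s) * exp (- t\<^sup>2 / (4 * s))))"
proof -
  define c where "c = sqrt (2 * s)"
  have c: "c > 0" and c2: "c\<^sup>2 = 2 * s" using s by (auto simp: c_def)
  interpret N: prob_space std_normal_distribution
    by (rule prob_space_normal_density) simp
  have int: "integrable lborel (\<lambda>v. std_normal_density v *\<^sub>R iexp (r * v))" for r
  proof -
    have "integrable std_normal_distribution (\<lambda>v. iexp (r * v))"
      by (rule N.integrable_iexp) auto
    then show ?thesis by (subst (asm) integrable_density) (auto simp: normal_density_nonneg)
  qed
  have "(\<integral>v. std_normal_density v *\<^sub>R iexp (r * v) \<partial>lborel) = complex_of_real (exp (- (r\<^sup>2) / 2))" for r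
    using fun_cong[OF char_std_normal_distribution, of r]
    unfolding char_def by (subst (asm) integral_density) (auto simp: normal_density_nonneg)
  then have *: "has_bochner_integral lborel (\<lambda>v. std_normal_density v *\<^sub>R iexp (r * v))
      (complex_of_real (exp (- (r\<^sup>2) / 2)))" for r
    using int by (simp add: has_bochner_integral_iff)
  have "has_bochner_integral lborel (\<lambda>u. std_normal_density (0 + c * u) *\<^sub>R iexp (t / c * (0 + c * u)))
      (complex_of_real (exp (- ((t / c)\<^sup>2) / 2)) /\<^sub>R \<bar>c\<bar>)"
    by (rule lborel_has_bochner_integral_real_affine_iff[THEN iffD1, OF _ *]) (use c in auto)
  then have "has_bochner_integral lborel (\<lambda>u. sqrt (2 * pi) *\<^sub>R (std_normal_density (0 + c * u) *\<^sub>R iexp (t / c * (0 + c * u))))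
      (sqrt (2 * pi) *\<^sub>R (complex_of_real (exp (- ((t / c)\<^sup>2) / 2)) /\<^sub>R \<bar>c\<bar>))"
    by (intro has_bochner_integral_scaleR_right) auto
  moreover have "sqrt (2 * pi) *\<^sub>R (std_normal_density (0 + c * u) *\<^sub>R iexp (t / c * (0 + c * u))) =
      complex_of_real (exp (- s * u\<^sup>2)) * exp (\<i> * complex_of_real (u * t))" for u
  proof -
    have "sqrt (2 * pi) * std_normal_density (0 + c * u) = exp (- s * u\<^sup>2)"
      using c2 by (simp add: std_normal_density_def power_mult_distrib)
    moreover have "t / c * (0 + c * u) = u * t" using c by simp
    ultimately show ?thesis by (metis scaleR_scaleR scaleR_conv_of_real)
  qed
  moreover have "sqrt (2 * pi) *\<^sub>R (complex_of_real (exp (- ((t / c)\<^sup>2) / 2)) /\<^sub>R \<bar>c\<bar>) =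
     complex_of_real (sqrt (pi / s) * exp (- t\<^sup>2 / (4 * s)))"
  proof -
    have "sqrt (2 * pi) / c = sqrt (pi / s)"
      using s by (simp add: c_def flip: real_sqrt_divide)
    moreover have "(t / c)\<^sup>2 / 2 = t\<^sup>2 / (4 * s)" by (simp add: power_divide c2)
    ultimately show ?thesis using c
      by (simp add: scaleR_conv_of_real field_simps flip: of_real_mult)
  qed
  ultimately show ?thesis by simp
qed

lemma Gaussian_integral:
  fixes s :: real
  assumes s: "s > 0"
  shows "has_bochner_integral lborel (\<lambda>u. exp (- s * u\<^sup>2)) (sqrt (pi / s))"
  using has_bochner_integral_bounded_linear[OF bounded_linear_Re Gaussian_fourier[OF s, of 0]] by simp

lemma Gaussian_integral_shift:
  fixes s t :: real
  assumes s: "s > 0"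
  shows "has_bochner_integral lborel (\<lambda>u. exp (- s * (t - u)\<^sup>2)) (sqrt (pi / s))"
proof -
  have "has_bochner_integral lborel (\<lambda>u. exp (- s * (t + - 1 * u)\<^sup>2)) (sqrt (pi / s) /\<^sub>R \<bar>- 1\<bar>)"
    by (rule lborel_has_bochner_integral_real_affine_iff[THEN iffD1, OF _ Gaussian_integral[OF s]]) simp
  then show ?thesis by simp
qed

text \<open>The Fourier transform of exp (- s u^2) at \<open>r\<close>, that is, 2 pi times the heat
  kernel at time \<open>s\<close>; it concentrates at 0 as \<open>s\<close> tends to 0.\<close>

definition heat_kernel :: "real \<Rightarrow> real \<Rightarrow> real" where
  "heat_kernel s r = sqrt (pi / s) * exp (- r\<^sup>2 / (4 * s))"

lemma heat_kernel_nonneg [simp]: "s > 0 \<Longrightarrow> 0 \<le> heat_kernel s r"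
  by (simp add: heat_kernel_def)

lemma heat_kernel_measurable [measurable]: "heat_kernel s \<in> borel_measurable borel"
  unfolding heat_kernel_def by measurable

lemma heat_kernel_minus_commute: "heat_kernel s (t - u) = heat_kernel s (u - t)"
  by (simp add: heat_kernel_def power2_commute)

lemma heat_kernel_integral:
  assumes s: "s > 0"
  shows "has_bochner_integral lborel (\<lambda>u. heat_kernel s (t - u)) (2 * pi)"
proof -
  have "has_bochner_integral lborel (\<lambda>u. sqrt (pi / s) * exp (- (1 / (4 * s)) * (t - u)\<^sup>2))
      (sqrt (pi / s) * sqrt (pi / (1 / (4 * s))))"
    by (intro has_bochner_integral_mult_right Gaussian_integral_shift) (use s in auto)
  moreover have "sqrt (pi / s) * sqrt (pi / (1 / (4 * s))) = 2 * pi"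
  proof -
    have "sqrt (pi / s) * sqrt (pi / (1 / (4 * s))) = sqrt ((2 * pi)\<^sup>2)"
      using s by (subst real_sqrt_mult[symmetric]) (simp add: power2_eq_square)
    then show ?thesis by (simp only: real_sqrt_abs) simp
  qed
  ultimately show ?thesis by (simp add: heat_kernel_def)
qed

lemma heat_kernel_nn_integral:
  assumes s: "s > 0"
  shows "(\<integral>\<^sup>+u. ennreal (heat_kernel s (t - u)) \<partial>lborel) = ennreal (2 * pi)"
  using heat_kernel_integral[OF s, of t] s
  by (subst nn_integral_eq_integral) (auto simp: has_bochner_integral_iff)

section \<open>The Fourier integral on integrable functions and its L2 bound\<close>

lemma fourier_integral_measurable [measurable]:
  assumes [measurable]: "g \<in> borel_measurable borel"
  shows "fourier_integral g \<in> borel_measurable borel"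
proof -
  have "(\<lambda>x. \<integral>t. g t * exp (- \<i> * complex_of_real (x * t)) \<partial>lborel) \<in> borel_measurable borel"
    by measurable
  then show ?thesis by (simp add: fourier_integral_def[abs_def])
qed

lemma fourier_integral_bound:
  "cmod (fourier_integral g x) \<le> (\<integral>t. cmod (g t) \<partial>lborel)"
  using integral_norm_bound[of lborel "\<lambda>t. g t * exp (- \<i> * complex_of_real (x * t))"]
  by (simp add: fourier_integral_def norm_mult)

text \<open>The multiplication formula. Both sides are iterated integrals of g(t) h(x) exp (- i x
  t), which is absolutely integrable on the plane because \<open>g\<close> and \<open>h\<close> are
  integrable.\<close>

lemma fourier_integral_exchange:
  assumes g: "integrable lborel g" and h: "integrable lborel h"
  shows "(\<integral>x. fourier_integral g x * h x \<partial>lborel) = (\<integral>t. g t * fourier_integral h t \<partial>lborel)"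
proof -
  have [measurable]: "g \<in> borel_measurable borel" "h \<in> borel_measurable borel"
    using g h by (auto dest: borel_measurable_integrable)
  define P where "P = (\<lambda>x t. h x * (g t * exp (- \<i> * complex_of_real (x * t))))"
  have [measurable]: "case_prod P \<in> borel_measurable (lborel \<Otimes>\<^sub>M lborel)"
    unfolding P_def by measurable
  have int: "integrable (lborel \<Otimes>\<^sub>M lborel) (case_prod P)"
  proof (rule lborel_pair.Fubini_integrable)
    show "integrable lborel (\<lambda>x. \<integral>y. norm (case_prod P (x, y)) \<partial>lborel)"
      using integrable_norm[OF h] by (simp add: P_def norm_mult)
    show "AE x in lborel. integrable lborel (\<lambda>y. case_prod P (x, y))"
    proof (intro AE_I2)
      fix x
      have "integrable lborel (\<lambda>y. h x * (g y * exp (- \<i> * complex_of_real (x * y))))"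
        by (intro integrable_mult_right Bochner_Integration.integrable_bound[OF integrable_norm[OF g]])
           (auto simp: norm_mult)
      then show "integrable lborel (\<lambda>y. case_prod P (x, y))" by (simp add: P_def)
    qed
  qed measurable
  have "(\<integral>x. fourier_integral g x * h x \<partial>lborel) = (\<integral>x. (\<integral>t. P x t \<partial>lborel) \<partial>lborel)"
    by (simp add: fourier_integral_def P_def mult.commute)
  also have "\<dots> = (\<integral>t. (\<integral>x. P x t \<partial>lborel) \<partial>lborel)"
    by (rule lborel_pair.Fubini_integral[OF int, symmetric])
  also have "\<dots> = (\<integral>t. g t * fourier_integral h t \<partial>lborel)"
  proof -
    have "P x t = g t * (h x * exp (- \<i> * complex_of_real (t * x)))" for x t
      by (simp add: P_def mult_ac)
    then show ?thesis
      by (simp only: fourier_integral_def[of h] integral_mult_right_zero)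
  qed
  finally show ?thesis .
qed

lemma Gaussian_wave_integrable:
  assumes "s > 0"
  shows "integrable lborel (\<lambda>u. complex_of_real (exp (- s * u\<^sup>2)) * exp (\<i> * complex_of_real (u * t)))"
  using Gaussian_fourier[OF assms, of t] by (simp add: has_bochner_integral_iff)

lemma fourier_integral_Gaussian_wave:
  assumes s: "s > 0"
  shows "fourier_integral (\<lambda>u. complex_of_real (exp (- s * u\<^sup>2)) * exp (\<i> * complex_of_real (u * t))) v
    = complex_of_real (heat_kernel s (t - v))"
proof -
  have "exp (\<i> * complex_of_real (u * t)) * exp (- \<i> * complex_of_real (v * u)) =
      exp (\<i> * complex_of_real (u * (t - v)))" for u
    by (simp add: algebra_simps flip: exp_add)
  then show ?thesis
    using has_bochner_integral_integral_eq[OF Gaussian_fourier[OF s, of "t - v"]]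
    by (simp add: fourier_integral_def heat_kernel_def mult.assoc)
qed

text \<open>Regularised inversion: a Gaussian cut-off in frequency is convolution with the heat
  kernel in time.\<close>

lemma fourier_integral_heat:
  assumes g: "integrable lborel g" and s: "s > 0"
  shows "(\<integral>x. fourier_integral g x *
      (complex_of_real (exp (- s * x\<^sup>2)) * exp (\<i> * complex_of_real (x * t))) \<partial>lborel)
    = (\<integral>u. g u * complex_of_real (heat_kernel s (t - u)) \<partial>lborel)"
  by (subst fourier_integral_exchange[OF g Gaussian_wave_integrable[OF s]])
     (simp only: fourier_integral_Gaussian_wave[OF s])

text \<open>A non-integrable function has Bochner integral 0, so both cases obey the bound and
  integrability need not be tracked in the estimates below.\<close>

lemma norm_integral_le_nn_integral:
  fixes f :: "'a \<Rightarrow> complex"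
  shows "ennreal (norm (integral\<^sup>L M f)) \<le> (\<integral>\<^sup>+x. ennreal (norm (f x)) \<partial>M)"
  by (cases "integrable M f") (auto intro: integral_norm_bound_ennreal simp: not_integrable_integral_eq)

text \<open>The Gaussian factor makes Fubini applicable.  Estimating \<open>|a b| \<le> a\<^sup>2 + b\<^sup>2\<close> costs a factor 2
  compared with Plancherel's constant \<open>2 pi\<close>, which is harmless here.\<close>

lemma fourier_integral_weighted_bound:
  assumes g: "integrable lborel g" and g2: "g \<in> L2 lborel" and s: "s > 0"
  shows "(\<integral>\<^sup>+x. ennreal (exp (- s * x\<^sup>2) * (cmod (fourier_integral g x))\<^sup>2) \<partial>lborel)
    \<le> ennreal (4 * pi * (L2_norm lborel g)\<^sup>2)"
proof -
  have [measurable]: "g \<in> borel_measurable borel"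
    using g by (auto dest: borel_measurable_integrable)
  have [measurable]: "fourier_integral g \<in> borel_measurable borel" by measurable
  define N where "N = (\<integral>t. cmod (g t) \<partial>lborel)"
  \<comment> \<open>With this \<open>h\<close> the weighted square is
    \<open>fourier_integral g x * h x\<close>. The multiplication formula moves the transform onto
    \<open>h\<close>, where it becomes the conjugate of the heat convolution of
    \<open>g\<close>.\<close>
  define h where "h = (\<lambda>x. cnj (fourier_integral g x) * complex_of_real (exp (- s * x\<^sup>2)))"
  have cm [measurable]: "(\<lambda>x. cnj (fourier_integral g x)) \<in> borel_measurable borel"
    by (rule measurable_compose[OF _ borel_measurable_continuous_onI]) (auto intro: continuous_intros)
  have [measurable]: "h \<in> borel_measurable borel"
    unfolding h_def by measurable
  have gauss: "integrable lborel (\<lambda>x. exp (- s * x\<^sup>2))"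
    using Gaussian_integral[OF s] by (simp add: has_bochner_integral_iff)
  have hint: "integrable lborel h"
  proof (rule Bochner_Integration.integrable_bound)
    show "integrable lborel (\<lambda>x. N * exp (- s * x\<^sup>2))" using gauss by simp
    show "AE x in lborel. norm (h x) \<le> norm (N * exp (- s * x\<^sup>2))"
      using fourier_integral_bound[of g] by (auto simp: h_def norm_mult N_def intro!: mult_right_mono)
  qed measurable
  have hw: "fourier_integral h t = cnj (\<integral>u. g u * complex_of_real (heat_kernel s (t - u)) \<partial>lborel)" for t
  proof -
    have "fourier_integral h t = (\<integral>x. cnj (fourier_integral g x *
      (complex_of_real (exp (- s * x\<^sup>2)) * exp (\<i> * complex_of_real (x * t)))) \<partial>lborel)"
      unfolding fourier_integral_def[of h] unfolding h_def by (simp add: exp_cnj mult_ac)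
    also have "\<dots> = cnj (\<integral>x. fourier_integral g x *
      (complex_of_real (exp (- s * x\<^sup>2)) * exp (\<i> * complex_of_real (x * t))) \<partial>lborel)"
      by (rule Bochner_Integration.integral_cnj)
    finally show ?thesis by (simp only: fourier_integral_heat[OF g s])
  qed
  have int: "integrable lborel (\<lambda>x. exp (- s * x\<^sup>2) * (cmod (fourier_integral g x))\<^sup>2)"
  proof (rule Bochner_Integration.integrable_bound)
    show "integrable lborel (\<lambda>x. N\<^sup>2 * exp (- s * x\<^sup>2))" using gauss by simp
    show "AE x in lborel. norm (exp (- s * x\<^sup>2) * (cmod (fourier_integral g x))\<^sup>2) \<le> norm (N\<^sup>2 * exp (- s * x\<^sup>2))"
      using fourier_integral_bound[of g] by (auto simp: N_def mult.commute intro!: mult_left_mono power_mono)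
  qed measurable
  have "(\<integral>\<^sup>+x. ennreal (exp (- s * x\<^sup>2) * (cmod (fourier_integral g x))\<^sup>2) \<partial>lborel)
      = ennreal (\<integral>x. exp (- s * x\<^sup>2) * (cmod (fourier_integral g x))\<^sup>2 \<partial>lborel)"
    by (rule nn_integral_eq_integral[OF int]) simp
  also have "(\<integral>x. exp (- s * x\<^sup>2) * (cmod (fourier_integral g x))\<^sup>2 \<partial>lborel)
      = norm (\<integral>x. complex_of_real (exp (- s * x\<^sup>2) * (cmod (fourier_integral g x))\<^sup>2) \<partial>lborel)"
    by (subst integral_complex_of_real) (auto intro!: integral_nonneg_AE)
  also have "(\<integral>x. complex_of_real (exp (- s * x\<^sup>2) * (cmod (fourier_integral g x))\<^sup>2) \<partial>lborel)
      = (\<integral>x. fourier_integral g x * h x \<partial>lborel)"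
    unfolding h_def of_real_mult complex_norm_square by (simp add: mult_ac)
  also have "\<dots> = (\<integral>t. g t * fourier_integral h t \<partial>lborel)"
    by (rule fourier_integral_exchange[OF g hint])
  also have "ennreal (norm \<dots>) \<le> (\<integral>\<^sup>+t. ennreal (norm (g t * fourier_integral h t)) \<partial>lborel)"
    by (rule norm_integral_le_nn_integral)
  also have "\<dots> = (\<integral>\<^sup>+t. ennreal (cmod (g t)) * ennreal (cmod (\<integral>u. g u * complex_of_real (heat_kernel s (t - u)) \<partial>lborel)) \<partial>lborel)"
    by (simp add: norm_mult hw ennreal_mult)
  also have "\<dots> \<le> (\<integral>\<^sup>+t. ennreal (cmod (g t)) * (\<integral>\<^sup>+u. ennreal (cmod (g u * complex_of_real (heat_kernel s (t - u)))) \<partial>lborel) \<partial>lborel)"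
    by (intro nn_integral_mono mult_left_mono norm_integral_le_nn_integral) auto
  also have "\<dots> = (\<integral>\<^sup>+t. \<integral>\<^sup>+u. ennreal (cmod (g t) * cmod (g u)) * ennreal (heat_kernel s (t - u)) \<partial>lborel \<partial>lborel)"
    using s by (subst nn_integral_cmult[symmetric]) (auto simp: norm_mult ennreal_mult mult_ac)
  also have "\<dots> \<le> (\<integral>\<^sup>+t. \<integral>\<^sup>+u. ennreal ((cmod (g t))\<^sup>2) * ennreal (heat_kernel s (t - u))
        + ennreal ((cmod (g u))\<^sup>2) * ennreal (heat_kernel s (t - u)) \<partial>lborel \<partial>lborel)"
  proof (intro nn_integral_mono)
    fix t u
    have "ennreal (cmod (g t) * cmod (g u)) \<le> ennreal ((cmod (g t))\<^sup>2 + (cmod (g u))\<^sup>2)"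
      using abs_mult_le_add_squares[of "cmod (g t)" "cmod (g u)"] by (intro ennreal_leI) simp
    then have "ennreal (cmod (g t) * cmod (g u)) * ennreal (heat_kernel s (t - u))
       \<le> (ennreal ((cmod (g t))\<^sup>2) + ennreal ((cmod (g u))\<^sup>2)) * ennreal (heat_kernel s (t - u))"
      by (intro mult_right_mono) (auto simp: ennreal_plus[symmetric] simp del: ennreal_plus)
    then show "ennreal (cmod (g t) * cmod (g u)) * ennreal (heat_kernel s (t - u))
       \<le> ennreal ((cmod (g t))\<^sup>2) * ennreal (heat_kernel s (t - u)) + ennreal ((cmod (g u))\<^sup>2) * ennreal (heat_kernel s (t - u))"
      by (simp add: distrib_right)
  qed
  also have "\<dots> = (\<integral>\<^sup>+t. \<integral>\<^sup>+u. ennreal ((cmod (g t))\<^sup>2) * ennreal (heat_kernel s (t - u)) \<partial>lborel \<partial>lborel)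
      + (\<integral>\<^sup>+t. \<integral>\<^sup>+u. ennreal ((cmod (g u))\<^sup>2) * ennreal (heat_kernel s (t - u)) \<partial>lborel \<partial>lborel)"
    by (simp add: nn_integral_add)
  \<comment> \<open>Exchanging the variables and using the symmetry of the kernel makes the two
    double integrals equal. Each is 2 pi times the squared norm of \<open>g\<close>, whence 4
    pi.\<close>
  also have "(\<integral>\<^sup>+t. \<integral>\<^sup>+u. ennreal ((cmod (g u))\<^sup>2) * ennreal (heat_kernel s (t - u)) \<partial>lborel \<partial>lborel)
      = (\<integral>\<^sup>+u. \<integral>\<^sup>+t. ennreal ((cmod (g u))\<^sup>2) * ennreal (heat_kernel s (u - t)) \<partial>lborel \<partial>lborel)"
    by (subst lborel_pair.Fubini') (auto simp: heat_kernel_minus_commute)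
  also have "(\<integral>\<^sup>+t. \<integral>\<^sup>+u. ennreal ((cmod (g t))\<^sup>2) * ennreal (heat_kernel s (t - u)) \<partial>lborel \<partial>lborel)
      = (\<integral>\<^sup>+t. ennreal ((cmod (g t))\<^sup>2) \<partial>lborel) * ennreal (2 * pi)"
    using s by (simp add: nn_integral_cmult heat_kernel_nn_integral nn_integral_multc)
  also have "(\<integral>\<^sup>+t. ennreal ((cmod (g t))\<^sup>2) \<partial>lborel) = ennreal ((L2_norm lborel g)\<^sup>2)"
    unfolding L2_norm_power2 by (rule nn_integral_eq_integral[OF L2_integrable[OF g2]]) simp
  finally show ?thesis
    by (simp add: algebra_simps flip: ennreal_mult ennreal_plus)
qed

text \<open>The weighted bound does not depend on \<open>s\<close>, so Fatou's lemma along s = 1 /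
  (n + 1) removes the Gaussian weight.\<close>

lemma fourier_integral_L2:
  assumes g: "integrable lborel g" and g2: "g \<in> L2 lborel"
  shows "fourier_integral g \<in> L2 lborel"
    and "L2_norm lborel (fourier_integral g) \<le> sqrt (4 * pi) * L2_norm lborel g"
proof -
  have [measurable]: "g \<in> borel_measurable borel"
    using g by (auto dest: borel_measurable_integrable)
  define R where "R = 4 * pi * (L2_norm lborel g)\<^sup>2"
  have R: "0 \<le> R" by (simp add: R_def)
  have lim: "liminf (\<lambda>n. ennreal (exp (- inverse (real (Suc n)) * x\<^sup>2) * (cmod (fourier_integral g x))\<^sup>2))
      = ennreal ((cmod (fourier_integral g x))\<^sup>2)" for x
  proof (rule lim_imp_Liminf)
    have "(\<lambda>n. exp (- inverse (real (Suc n)) * x\<^sup>2) * (cmod (fourier_integral g x))\<^sup>2)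
        \<longlonglongrightarrow> exp (- 0 * x\<^sup>2) * (cmod (fourier_integral g x))\<^sup>2"
      by (intro tendsto_intros LIMSEQ_inverse_real_of_nat)
    then show "(\<lambda>n. ennreal (exp (- inverse (real (Suc n)) * x\<^sup>2) * (cmod (fourier_integral g x))\<^sup>2))
      \<longlonglongrightarrow> ennreal ((cmod (fourier_integral g x))\<^sup>2)"
      by (intro tendsto_ennrealI) simp
  qed simp
  have "(\<integral>\<^sup>+x. ennreal ((cmod (fourier_integral g x))\<^sup>2) \<partial>lborel) =
     (\<integral>\<^sup>+x. liminf (\<lambda>n. ennreal (exp (- inverse (real (Suc n)) * x\<^sup>2) * (cmod (fourier_integral g x))\<^sup>2)) \<partial>lborel)"
    by (simp only: lim)
  also have "\<dots> \<le> liminf (\<lambda>n. \<integral>\<^sup>+x. ennreal (exp (- inverse (real (Suc n)) * x\<^sup>2) * (cmod (fourier_integral g x))\<^sup>2) \<partial>lborel)"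
    by (rule nn_integral_liminf) measurable
  also have "\<dots> \<le> ennreal R"
    unfolding R_def
    by (intro Liminf_le always_eventually allI fourier_integral_weighted_bound[OF g g2]) auto
  finally have le: "(\<integral>\<^sup>+x. ennreal ((cmod (fourier_integral g x))\<^sup>2) \<partial>lborel) \<le> ennreal R" .
  have int: "integrable lborel (\<lambda>x. (cmod (fourier_integral g x))\<^sup>2)"
    by (rule integrableI_bounded) (use le in \<open>auto simp: less_top[symmetric] top_unique\<close>)
  then show "fourier_integral g \<in> L2 lborel" by (simp add: L2_def)
  have "(\<integral>x. (cmod (fourier_integral g x))\<^sup>2 \<partial>lborel) \<le> R"
    using le R by (subst (asm) nn_integral_eq_integral[OF int]) auto
  then show "L2_norm lborel (fourier_integral g) \<le> sqrt (4 * pi) * L2_norm lborel g"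
    unfolding L2_norm_def[of _ "fourier_integral g"]
    by (intro real_le_lsqrt) (auto simp: R_def power_mult_distrib)
qed

section \<open>The Paley--Wiener space\<close>

lemma L2_pairing_tendsto:
  assumes f: "\<And>n. f n \<in> L2 M" and g: "g \<in> L2 M" and w: "w \<in> L2 M"
    and lim: "(\<lambda>n. L2_norm M (\<lambda>t. f n t - g t)) \<longlonglongrightarrow> 0"
  shows "(\<lambda>n. \<integral>t. f n t * w t \<partial>M) \<longlonglongrightarrow> (\<integral>t. g t * w t \<partial>M)"
proof -
  have "(\<lambda>n. (\<integral>t. f n t * w t \<partial>M) - (\<integral>t. g t * w t \<partial>M)) \<longlonglongrightarrow> 0"
  proof (rule Lim_null_comparison)
    show "\<forall>\<^sub>F n in sequentially. norm ((\<integral>t. f n t * w t \<partial>M) - (\<integral>t. g t * w t \<partial>M))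
        \<le> L2_norm M (\<lambda>t. f n t - g t) * L2_norm M w"
    proof (intro always_eventually allI)
      fix n
      have "(\<integral>t. f n t * w t \<partial>M) - (\<integral>t. g t * w t \<partial>M) = (\<integral>t. (f n t - g t) * w t \<partial>M)"
        using L2_mult_integrable[OF f w, of n] L2_mult_integrable[OF g w] by (simp add: left_diff_distrib)
      then show "norm ((\<integral>t. f n t * w t \<partial>M) - (\<integral>t. g t * w t \<partial>M))
        \<le> L2_norm M (\<lambda>t. f n t - g t) * L2_norm M w"
        using L2_Cauchy_Schwarz[OF L2_diff[OF f g] w, of n] by simp
    qed
    show "(\<lambda>n. L2_norm M (\<lambda>t. f n t - g t) * L2_norm M w) \<longlonglongrightarrow> 0"
      using tendsto_mult_right[OF lim, of "L2_norm M w"] by simp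
  qed
  then show ?thesis by (simp add: LIM_zero_iff)
qed

lemma Gaussian_L2:
  assumes s: "s > 0"
  shows "(\<lambda>u. complex_of_real (exp (- s * u\<^sup>2)) * exp (\<i> * complex_of_real (u * t))) \<in> L2 lborel"
proof -
  have "(exp (- s * u\<^sup>2))\<^sup>2 = exp (- (2 * s) * u\<^sup>2)" for u :: real
    by (simp flip: exp_double)
  then have "integrable lborel (\<lambda>u. (exp (- s * u\<^sup>2))\<^sup>2)"
    using Gaussian_integral[of "2 * s"] s by (simp add: has_bochner_integral_iff)
  then show ?thesis by (simp add: L2_def norm_mult)
qed

lemma Gaussian_shift_L2:
  assumes s: "s > 0"
  shows "(\<lambda>u. complex_of_real (exp (- s * (t - u)\<^sup>2))) \<in> L2 lborel"
proof -
  have "(exp (- s * (t - u)\<^sup>2))\<^sup>2 = exp (- (2 * s) * (t - u)\<^sup>2)" for u :: real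
    by (simp flip: exp_double)
  then have "integrable lborel (\<lambda>u. (exp (- s * (t - u)\<^sup>2))\<^sup>2)"
    using Gaussian_integral_shift[of "2 * s" t] s by (simp add: has_bochner_integral_iff)
  then show ?thesis by (simp add: L2_def)
qed

lemma heat_kernel_L2:
  assumes s: "s > 0"
  shows "(\<lambda>u. complex_of_real (heat_kernel s (t - u))) \<in> L2 lborel"
proof -
  have "complex_of_real (heat_kernel s (t - u)) =
      complex_of_real (sqrt (pi / s)) * complex_of_real (exp (- (1 / (4 * s)) * (t - u)\<^sup>2))" for u
    by (simp add: heat_kernel_def)
  then show ?thesis
    using L2_scale[OF Gaussian_shift_L2[of "1 / (4 * s)" t], of "complex_of_real (sqrt (pi / s))"] s by simp
qed

text \<open>A Fourier transform on \<open>L\<^sub>2\<close> is known explicitly only on integrable functions; Gaussian damping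
  approximates an arbitrary element of \<open>L\<^sub>2\<close> by such functions.\<close>

definition damp :: "nat \<Rightarrow> (real \<Rightarrow> complex) \<Rightarrow> real \<Rightarrow> complex" where
  "damp n f t = complex_of_real (exp (- inverse (real (Suc n)) * t\<^sup>2)) * f t"

lemma damp_L2: "f \<in> L2 lborel \<Longrightarrow> damp n f \<in> L2 lborel"
  unfolding damp_def[abs_def] by (rule L2_bounded_mult[where K=1]) (auto simp del: of_nat_Suc)

lemma damp_integrable:
  assumes "f \<in> L2 lborel" shows "integrable lborel (damp n f)"
  using L2_mult_integrable[OF Gaussian_L2[of "inverse (real (Suc n))" 0] assms]
  by (simp add: damp_def[abs_def] del: of_nat_Suc)

lemma damp_tendsto:
  assumes f: "f \<in> L2 lborel"
  shows "(\<lambda>n. L2_norm lborel (\<lambda>t. damp n f t - f t)) \<longlonglongrightarrow> 0"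
proof -
  note [measurable] = L2_measurable[OF f]
  have "(\<lambda>n. \<integral>t. (cmod (damp n f t - f t))\<^sup>2 \<partial>lborel) \<longlonglongrightarrow> (\<integral>t. 0 \<partial>(lborel :: real measure))"
  proof (rule integral_dominated_convergence[where w="\<lambda>t. (cmod (f t))\<^sup>2"])
    show "integrable lborel (\<lambda>t. (cmod (f t))\<^sup>2)" by (rule L2_integrable[OF f])
    show "AE t in lborel. (\<lambda>n. (cmod (damp n f t - f t))\<^sup>2) \<longlonglongrightarrow> 0"
    proof (intro AE_I2)
      fix t
      have "(\<lambda>n. (cmod (damp n f t - f t))\<^sup>2) \<longlonglongrightarrow>
          (cmod (complex_of_real (exp (- 0 * t\<^sup>2)) * f t - f t))\<^sup>2"
        unfolding damp_def by (intro tendsto_intros LIMSEQ_inverse_real_of_nat)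
      then show "(\<lambda>n. (cmod (damp n f t - f t))\<^sup>2) \<longlonglongrightarrow> 0" by simp
    qed
    show "AE t in lborel. norm ((cmod (damp n f t - f t))\<^sup>2) \<le> (cmod (f t))\<^sup>2" for n
    proof (intro AE_I2)
      fix t
      define e where "e = exp (- inverse (real (Suc n)) * t\<^sup>2)"
      have e: "0 \<le> e" "e \<le> 1" by (auto simp: e_def simp del: of_nat_Suc)
      have "damp n f t - f t = complex_of_real (e - 1) * f t"
        by (simp add: damp_def e_def algebra_simps)
      then have "cmod (damp n f t - f t) = \<bar>e - 1\<bar> * cmod (f t)"
        by (simp only: norm_mult norm_of_real)
      also have "\<dots> \<le> 1 * cmod (f t)" using e by (intro mult_right_mono) auto
      finally show "norm ((cmod (damp n f t - f t))\<^sup>2) \<le> (cmod (f t))\<^sup>2" by (simp add: power_mono)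
    qed
  qed (auto simp: damp_def)
  then have "(\<lambda>n. sqrt (\<integral>t. (cmod (damp n f t - f t))\<^sup>2 \<partial>lborel)) \<longlonglongrightarrow> sqrt 0"
    by (intro tendsto_intros) simp
  then show ?thesis by (simp add: L2_norm_def)
qed

text \<open>Boundedness of \<open>F\<close> carries the L2 convergence of the damped functions over
  to their images, and on damped functions \<open>F\<close> is the explicit integral. This makes
  every value of \<open>F\<close> an L2 limit of known functions.\<close>

lemma fourier_transform_damp_tendsto:
  assumes F: "is_fourier_transform F" and f: "f \<in> L2 lborel"
  shows "(\<lambda>n. L2_norm lborel (\<lambda>x. fourier_integral (damp n f) x - F f x)) \<longlonglongrightarrow> 0"
proof -
  from F obtain C where C: "\<And>g. g \<in> L2 lborel \<Longrightarrow> L2_norm lborel (F g) \<le> C * L2_norm lborel g"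
    by (auto simp: is_fourier_transform_def)
  have FL2: "F g \<in> L2 lborel" if "g \<in> L2 lborel" for g
    using F that by (auto simp: is_fourier_transform_def linear_operator_into_L2_def)
  have lin: "AE x in lborel. F (\<lambda>t. a * g t + b * h t) x = a * F g x + b * F h x"
    if "g \<in> L2 lborel" "h \<in> L2 lborel" for a b g h
    using F that by (auto simp: is_fourier_transform_def linear_operator_into_L2_def)
  show ?thesis
  proof (rule Lim_null_comparison)
    show "(\<lambda>n. C * L2_norm lborel (\<lambda>t. damp n f t - f t)) \<longlonglongrightarrow> 0"
      using tendsto_mult_left[OF damp_tendsto[OF f], of C] by simp
    show "\<forall>\<^sub>F n in sequentially. norm (L2_norm lborel (\<lambda>x. fourier_integral (damp n f) x - F f x))
        \<le> C * L2_norm lborel (\<lambda>t. damp n f t - f t)"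
    proof (intro always_eventually allI)
      fix n
      note dn = damp_L2[OF f, of n] damp_integrable[OF f, of n]
      have d: "(\<lambda>t. damp n f t - f t) \<in> L2 lborel" by (rule L2_diff[OF dn(1) f])
      have 1: "AE x in lborel. F (damp n f) x = fourier_integral (damp n f) x"
        using F dn by (auto simp: is_fourier_transform_def)
      have 2: "AE x in lborel. F (\<lambda>t. damp n f t - f t) x = F (damp n f) x - F f x"
        using lin[OF dn(1) f, of 1 "- 1"] by simp
      have "L2_norm lborel (\<lambda>x. fourier_integral (damp n f) x - F f x) =
          L2_norm lborel (F (\<lambda>t. damp n f t - f t))"
      proof (rule L2_norm_cong_AE)
        show "(\<lambda>x. fourier_integral (damp n f) x - F f x) \<in> borel_measurable lborel"
          by (rule L2_measurable[OF L2_diff[OF fourier_integral_L2(1)[OF dn(2,1)] FL2[OF f]]])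
        show "F (\<lambda>t. damp n f t - f t) \<in> borel_measurable lborel"
          by (rule L2_measurable[OF FL2[OF d]])
        show "AE x in lborel. fourier_integral (damp n f) x - F f x = F (\<lambda>t. damp n f t - f t) x"
          using 1 2 by eventually_elim simp
      qed
      then show "norm (L2_norm lborel (\<lambda>x. fourier_integral (damp n f) x - F f x))
        \<le> C * L2_norm lborel (\<lambda>t. damp n f t - f t)"
        using C[OF d] by simp
    qed
  qed
qed

section \<open>Norm bound and inversion for an abstract Fourier transform\<close>

lemma fourier_transform_L2:
  assumes F: "is_fourier_transform F" and f: "f \<in> L2 lborel"
  shows "F f \<in> L2 lborel"
  using F f by (auto simp: is_fourier_transform_def linear_operator_into_L2_def)

text \<open>\<open>PW_pi\<close> allows a different \<open>F\<close> for each function, so the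
  unspecified constant in \<open>is_fourier_transform\<close> would not be uniform. Passing to the
  limit in the bound for damped functions replaces it by a universal one.\<close>

lemma fourier_transform_bound:
  assumes F: "is_fourier_transform F" and f: "f \<in> L2 lborel"
  shows "L2_norm lborel (F f) \<le> sqrt (4 * pi) * L2_norm lborel f"
proof (rule LIMSEQ_le_const)
  show "(\<lambda>n. sqrt (4 * pi) * (L2_norm lborel f + L2_norm lborel (\<lambda>t. damp n f t - f t)) +
      L2_norm lborel (\<lambda>x. fourier_integral (damp n f) x - F f x)) \<longlonglongrightarrow> sqrt (4 * pi) * L2_norm lborel f"
    using damp_tendsto[OF f] fourier_transform_damp_tendsto[OF F f]
    by (auto intro!: tendsto_eq_intros)
  show "\<exists>N. \<forall>n\<ge>N. L2_norm lborel (F f) \<le>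
     sqrt (4 * pi) * (L2_norm lborel f + L2_norm lborel (\<lambda>t. damp n f t - f t)) +
      L2_norm lborel (\<lambda>x. fourier_integral (damp n f) x - F f x)"
  proof (intro exI allI impI)
    fix n
    note dn = damp_L2[OF f, of n] damp_integrable[OF f, of n]
    have "L2_norm lborel (F f) \<le> L2_norm lborel (fourier_integral (damp n f)) +
        L2_norm lborel (\<lambda>x. fourier_integral (damp n f) x - F f x)"
      using L2_norm_le_add_diff[OF fourier_transform_L2[OF F f] fourier_integral_L2(1)[OF dn(2,1)]]
      by (simp add: L2_norm_minus_commute)
    also have "L2_norm lborel (fourier_integral (damp n f)) \<le> sqrt (4 * pi) * L2_norm lborel (damp n f)"
      by (rule fourier_integral_L2(2)[OF dn(2,1)])
    also have "\<dots> \<le> sqrt (4 * pi) * (L2_norm lborel f + L2_norm lborel (\<lambda>t. damp n f t - f t))"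
      by (intro mult_left_mono L2_norm_le_add_diff dn f) auto
    finally show "L2_norm lborel (F f) \<le>
     sqrt (4 * pi) * (L2_norm lborel f + L2_norm lborel (\<lambda>t. damp n f t - f t)) +
      L2_norm lborel (\<lambda>x. fourier_integral (damp n f) x - F f x)" by simp
  qed
qed

text \<open>For damped functions this is \<open>fourier_integral_heat\<close>. Both sides are
  pairings with fixed L2 functions, hence survive the limit.\<close>

lemma fourier_transform_heat:
  assumes F: "is_fourier_transform F" and f: "f \<in> L2 lborel" and s: "s > 0"
  shows "(\<integral>x. F f x * (complex_of_real (exp (- s * x\<^sup>2)) * exp (\<i> * complex_of_real (x * t))) \<partial>lborel)
    = (\<integral>u. f u * complex_of_real (heat_kernel s (t - u)) \<partial>lborel)"
proof (rule LIMSEQ_unique)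
  show "(\<lambda>n. \<integral>u. damp n f u * complex_of_real (heat_kernel s (t - u)) \<partial>lborel) \<longlonglongrightarrow>
      (\<integral>u. f u * complex_of_real (heat_kernel s (t - u)) \<partial>lborel)"
    by (rule L2_pairing_tendsto[OF damp_L2[OF f] f heat_kernel_L2[OF s] damp_tendsto[OF f]])
  have "(\<lambda>n. \<integral>x. fourier_integral (damp n f) x * (complex_of_real (exp (- s * x\<^sup>2)) * exp (\<i> * complex_of_real (x * t))) \<partial>lborel)
    \<longlonglongrightarrow> (\<integral>x. F f x * (complex_of_real (exp (- s * x\<^sup>2)) * exp (\<i> * complex_of_real (x * t))) \<partial>lborel)"
    by (rule L2_pairing_tendsto[OF fourier_integral_L2(1)[OF damp_integrable[OF f] damp_L2[OF f]]
          fourier_transform_L2[OF F f] Gaussian_L2[OF s] fourier_transform_damp_tendsto[OF F f]])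
  then show "(\<lambda>n. \<integral>u. damp n f u * complex_of_real (heat_kernel s (t - u)) \<partial>lborel) \<longlonglongrightarrow>
    (\<integral>x. F f x * (complex_of_real (exp (- s * x\<^sup>2)) * exp (\<i> * complex_of_real (x * t))) \<partial>lborel)"
    by (simp only: fourier_integral_heat[OF damp_integrable[OF f] s])
qed

text \<open>At s = 1 / N the exponent is N r^2 / 4. One half is estimated by r^2 \<ge> \<eta>^2 and
  makes the prefactor tend to 0; the other half is estimated by N \<ge> 1 and leaves a fixed
  integrable Gaussian in \<open>r\<close>.\<close>

lemma heat_kernel_tail_bound:
  assumes r: "\<eta> \<le> \<bar>r\<bar>" "0 < \<eta>"
  shows "heat_kernel (inverse (real (Suc n))) r
    \<le> sqrt (pi * real (Suc n)) * exp (- \<eta>\<^sup>2 / 8 * real (Suc n)) * exp (- (1 / 8) * r\<^sup>2)"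
proof -
  define N where "N = real (Suc n)"
  have N: "N \<ge> 1" by (simp add: N_def)
  have "\<eta>\<^sup>2 \<le> r\<^sup>2" using r by (simp add: abs_le_square_iff[symmetric])
  then have "\<eta>\<^sup>2 * N \<le> r\<^sup>2 * N" using N by (intro mult_right_mono) auto
  moreover have "r\<^sup>2 * 1 \<le> r\<^sup>2 * N" using N by (intro mult_left_mono) auto
  moreover have "- r\<^sup>2 / (4 * inverse N) = - (r\<^sup>2 * N) / 4"
    by (simp add: inverse_eq_divide)
  ultimately have "- r\<^sup>2 / (4 * inverse N) \<le> - \<eta>\<^sup>2 / 8 * N + (- (1 / 8) * r\<^sup>2)"
    by linarith
  then have "exp (- r\<^sup>2 / (4 * inverse N)) \<le> exp (- \<eta>\<^sup>2 / 8 * N) * exp (- (1 / 8) * r\<^sup>2)"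
    by (simp only: exp_le_cancel_iff flip: exp_add)
  then have "sqrt (pi * N) * exp (- r\<^sup>2 / (4 * inverse N)) \<le>
      sqrt (pi * N) * (exp (- \<eta>\<^sup>2 / 8 * N) * exp (- (1 / 8) * r\<^sup>2))"
    using N by (intro mult_left_mono) auto
  then show ?thesis
    unfolding heat_kernel_def N_def[symmetric] by (simp only: divide_inverse inverse_inverse_eq mult.assoc)
qed

text \<open>Near \<open>t\<close> continuity controls the integrand. Away from \<open>t\<close> the
  function may be unbounded, so boundedness is replaced by integrability of \<open>f\<close> against
  the fixed Gaussian from the tail bound.\<close>

lemma heat_kernel_approximate_identity:
  assumes f: "f \<in> L2 lborel" and cont: "continuous_on UNIV f"
  shows "(\<lambda>n. \<integral>u. f u * complex_of_real (heat_kernel (inverse (real (Suc n))) (t - u)) \<partial>lborel)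
    \<longlonglongrightarrow> complex_of_real (2 * pi) * f t"
proof -
  note [measurable] = L2_measurable[OF f]
  define K where "K = (\<lambda>n u. heat_kernel (inverse (real (Suc n))) (t - u))"
  define E where "E = (\<lambda>u. exp (- (1 / 8) * (t - u)\<^sup>2))"
  have K0: "0 \<le> K n u" for n u unfolding K_def by (rule heat_kernel_nonneg) simp
  have Kint: "has_bochner_integral lborel (K n) (2 * pi)" for n
    unfolding K_def by (rule heat_kernel_integral) simp
  have KL2: "(\<lambda>u. complex_of_real (K n u)) \<in> L2 lborel" for n
    unfolding K_def by (rule heat_kernel_L2) simp
  have Eint: "integrable lborel E"
    unfolding E_def using Gaussian_integral_shift[of "1/8" t] by (simp only: has_bochner_integral_iff)
  have fE: "integrable lborel (\<lambda>u. cmod (f u) * E u)"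
    using integrable_norm[OF L2_mult_integrable[OF f Gaussian_shift_L2[of "1/8" t]]]
    by (simp add: norm_mult E_def)
  \<comment> \<open>A majorant, independent of \<open>n\<close>, for |f(u) - f(t)| times the
    Gaussian left over by the tail bound.\<close>
  define D where "D = (\<lambda>u. cmod (f u) * E u + cmod (f t) * E u)"
  have Dint: "integrable lborel D" unfolding D_def using fE Eint by simp
  have fK: "integrable lborel (\<lambda>u. f u * complex_of_real (K n u))" for n
    by (rule L2_mult_integrable[OF f KL2])
  have cK: "has_bochner_integral lborel (\<lambda>u. f t * complex_of_real (K n u)) (f t * complex_of_real (2 * pi))" for n
    by (intro has_bochner_integral_mult_right has_bochner_integral_of_real Kint)
  have eq: "(\<integral>u. f u * complex_of_real (K n u) \<partial>lborel) - complex_of_real (2 * pi) * f t =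
      (\<integral>u. (f u - f t) * complex_of_real (K n u) \<partial>lborel)" for n
    using fK[of n] cK[of n] by (auto simp: left_diff_distrib has_bochner_integral_iff)
  have "(\<lambda>n. \<integral>u. f u * complex_of_real (K n u) \<partial>lborel) \<longlonglongrightarrow> complex_of_real (2 * pi) * f t"
    unfolding tendsto_iff dist_norm eq
  proof (intro allI impI)
    fix e :: real assume e: "e > 0"
    \<comment> \<open>The kernel has mass 2 pi, so an oscillation below \<open>d\<close> near
      \<open>t\<close> contributes at most e / 2.\<close>
    define d where "d = e / (4 * pi)"
    have d: "d > 0" using e by (simp add: d_def)
    have "isCont f t" using cont by (simp add: continuous_on_eq_continuous_at)
    then obtain \<eta> where eta: "\<eta> > 0" "\<And>u. dist u t < \<eta> \<Longrightarrow> dist (f u) (f t) < d"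
      using d unfolding continuous_at_eps_delta by blast
    define c where "c = (\<lambda>n. sqrt (pi * real (Suc n)) * exp (- \<eta>\<^sup>2 / 8 * real (Suc n)))"
    have c0: "0 \<le> c n" for n by (simp add: c_def)
    have "c \<longlonglongrightarrow> 0"
    proof -
      have a: "\<eta>\<^sup>2 / 8 > 0" using eta by simp
      have "(\<lambda>n. sqrt (pi * real (Suc n)) * exp (- a * real (Suc n))) \<longlonglongrightarrow> 0" if "a > 0" for a :: real
        using that by real_asymp
      from this[OF a] show ?thesis by (simp add: c_def[abs_def])
    qed
    then have "(\<lambda>n. d * (2 * pi) + c n * (\<integral>u. D u \<partial>lborel)) \<longlonglongrightarrow> d * (2 * pi) + 0 * (\<integral>u. D u \<partial>lborel)"
      by (intro tendsto_intros)
    moreover have "d * (2 * pi) + 0 * (\<integral>u. D u \<partial>lborel) < e" using e by (simp add: d_def)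
    ultimately have "\<forall>\<^sub>F n in sequentially. d * (2 * pi) + c n * (\<integral>u. D u \<partial>lborel) < e"
      by (rule order_tendstoD)
    moreover have "norm (\<integral>u. (f u - f t) * complex_of_real (K n u) \<partial>lborel)
        \<le> d * (2 * pi) + c n * (\<integral>u. D u \<partial>lborel)" for n
    proof -
      have "norm (\<integral>u. (f u - f t) * complex_of_real (K n u) \<partial>lborel)
          \<le> (\<integral>u. d * K n u + c n * D u \<partial>lborel)"
      proof (rule order_trans[OF integral_norm_bound integral_mono])
        show "integrable lborel (\<lambda>u. norm ((f u - f t) * complex_of_real (K n u)))"
          using fK[of n] cK[of n] by (intro integrable_norm) (simp add: left_diff_distrib has_bochner_integral_iff)
        show "integrable lborel (\<lambda>u. d * K n u + c n * D u)"
          using Kint[of n] Dint by (simp add: has_bochner_integral_iff)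
        fix u
        show "norm ((f u - f t) * complex_of_real (K n u)) \<le> d * K n u + c n * D u"
        proof (cases "dist u t < \<eta>")
          case True
          have "norm ((f u - f t) * complex_of_real (K n u)) = dist (f u) (f t) * K n u"
            using K0 by (simp add: norm_mult dist_norm)
          also have "\<dots> \<le> d * K n u"
            using eta(2)[OF True] K0 by (intro mult_right_mono) auto
          also have "\<dots> \<le> d * K n u + c n * D u"
            using c0 by (simp add: D_def E_def)
          finally show ?thesis .
        next
          case False
          have "norm ((f u - f t) * complex_of_real (K n u)) = cmod (f u - f t) * K n u"
            using K0 by (simp add: norm_mult)
          also have "\<dots> \<le> (cmod (f u) + cmod (f t)) * (c n * E u)"
          proof (rule mult_mono)
            show "K n u \<le> c n * E u"
              unfolding K_def c_def E_def
              by (rule heat_kernel_tail_bound) (use False eta in \<open>auto simp: dist_real_def\<close>)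
          qed (auto intro: norm_triangle_ineq4 K0)
          also have "\<dots> = c n * D u" by (simp add: D_def algebra_simps)
          also have "\<dots> \<le> d * K n u + c n * D u" using d K0 by simp
          finally show ?thesis .
        qed
      qed
      also have "\<dots> = d * (2 * pi) + c n * (\<integral>u. D u \<partial>lborel)"
        using Kint[of n] Dint by (simp add: has_bochner_integral_iff)
      finally show ?thesis .
    qed
    ultimately show "\<forall>\<^sub>F n in sequentially. norm (\<integral>u. (f u - f t) * complex_of_real (K n u) \<partial>lborel) < e"
      by (auto elim!: eventually_mono intro: le_less_trans)
  qed
  then show ?thesis by (simp add: K_def)
qed

lemma indicator_L2:
  assumes "A \<in> sets lborel" "emeasure lborel A < \<infinity>"
  shows "(\<lambda>x. complex_of_real (indicator A x)) \<in> L2 lborel"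
proof -
  have "(cmod (complex_of_real (indicator A x)))\<^sup>2 = indicator A x" for x :: real
    by (simp add: indicator_def)
  then show ?thesis
    using assms by (simp add: L2_def)
qed

text \<open>\<open>h\<close> is \<open>F f\<close> set to 0 everywhere outside the interval, which
  alters it only on a null set. Bounded support makes \<open>h\<close> integrable, so the Gaussian
  cut-off in frequency can be removed by dominated convergence. On the time side the same limit is 2
  pi f(t) at every point because \<open>f\<close> is continuous.\<close>

lemma PW_pi_representation:
  assumes f: "f \<in> PW_pi"
  obtains h where "h \<in> L2 lborel" "L2_norm lborel h \<le> sqrt (4 * pi) * L2_norm lborel f"
    and "\<And>x. x \<notin> {-pi..pi} \<Longrightarrow> h x = 0"
    and "\<And>t. complex_of_real (2 * pi) * f t = (\<integral>x. h x * exp (\<i> * complex_of_real (x * t)) \<partial>lborel)"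
proof -
  from f obtain F where F: "is_fourier_transform F" and f2: "f \<in> L2 lborel" and cont: "continuous_on UNIV f"
    and out: "AE x in lborel. x \<notin> {-pi..pi} \<longrightarrow> F f x = 0"
    by (auto simp: PW_pi_def)
  note FL = fourier_transform_L2[OF F f2]
  note [measurable] = L2_measurable[OF FL]
  define h where "h = (\<lambda>x. complex_of_real (indicator {-pi..pi} x) * F f x)"
  have hL: "h \<in> L2 lborel"
    unfolding h_def by (rule L2_bounded_mult[OF FL, where K=1]) (auto simp: indicator_def)
  note [measurable] = L2_measurable[OF hL]
  have hint: "integrable lborel h"
    unfolding h_def by (intro L2_mult_integrable indicator_L2 FL) auto
  have eq: "AE x in lborel. F f x = h x"
    using out by eventually_elim (auto simp: h_def indicator_def)
  have inv: "complex_of_real (2 * pi) * f t = (\<integral>x. h x * exp (\<i> * complex_of_real (x * t)) \<partial>lborel)" for t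
  proof (rule LIMSEQ_unique)
    show "(\<lambda>n. \<integral>u. f u * complex_of_real (heat_kernel (inverse (real (Suc n))) (t - u)) \<partial>lborel)
      \<longlonglongrightarrow> complex_of_real (2 * pi) * f t"
      by (rule heat_kernel_approximate_identity[OF f2 cont])
    have "(\<integral>u. f u * complex_of_real (heat_kernel (inverse (real (Suc n))) (t - u)) \<partial>lborel)
       = (\<integral>x. h x * (complex_of_real (exp (- inverse (real (Suc n)) * x\<^sup>2)) * exp (\<i> * complex_of_real (x * t))) \<partial>lborel)" for n
      by (subst fourier_transform_heat[OF F f2, symmetric], simp, rule integral_cong_AE) (use eq in auto)
    moreover have "(\<lambda>n. \<integral>x. h x * (complex_of_real (exp (- inverse (real (Suc n)) * x\<^sup>2)) * exp (\<i> * complex_of_real (x * t))) \<partial>lborel)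
      \<longlonglongrightarrow> (\<integral>x. h x * exp (\<i> * complex_of_real (x * t)) \<partial>lborel)"
    proof (rule integral_dominated_convergence[where w="\<lambda>x. cmod (h x)"])
      show "AE x in lborel. (\<lambda>n. h x * (complex_of_real (exp (- inverse (real (Suc n)) * x\<^sup>2)) * exp (\<i> * complex_of_real (x * t))))
          \<longlonglongrightarrow> h x * exp (\<i> * complex_of_real (x * t))"
      proof (intro AE_I2)
        fix x
        have "(\<lambda>n. h x * (complex_of_real (exp (- inverse (real (Suc n)) * x\<^sup>2)) * exp (\<i> * complex_of_real (x * t))))
          \<longlonglongrightarrow> h x * (complex_of_real (exp (- 0 * x\<^sup>2)) * exp (\<i> * complex_of_real (x * t)))"
          by (intro tendsto_intros LIMSEQ_inverse_real_of_nat)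
        then show "(\<lambda>n. h x * (complex_of_real (exp (- inverse (real (Suc n)) * x\<^sup>2)) * exp (\<i> * complex_of_real (x * t))))
          \<longlonglongrightarrow> h x * exp (\<i> * complex_of_real (x * t))" by simp
      qed
      show "AE x in lborel. norm (h x * (complex_of_real (exp (- inverse (real (Suc n)) * x\<^sup>2)) * exp (\<i> * complex_of_real (x * t)))) \<le> cmod (h x)" for n
      proof (intro AE_I2)
        fix x
        have "exp (- inverse (real (Suc n)) * x\<^sup>2) \<le> 1" by (simp del: of_nat_Suc)
        then have "cmod (h x) * exp (- inverse (real (Suc n)) * x\<^sup>2) \<le> cmod (h x) * 1"
          by (intro mult_left_mono) auto
        then show "norm (h x * (complex_of_real (exp (- inverse (real (Suc n)) * x\<^sup>2)) * exp (\<i> * complex_of_real (x * t)))) \<le> cmod (h x)"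
          by (simp add: norm_mult del: of_nat_Suc)
      qed
    qed (use hint in auto)
    ultimately show "(\<lambda>n. \<integral>u. f u * complex_of_real (heat_kernel (inverse (real (Suc n))) (t - u)) \<partial>lborel)
      \<longlonglongrightarrow> (\<integral>x. h x * exp (\<i> * complex_of_real (x * t)) \<partial>lborel)" by simp
  qed
  have "L2_norm lborel h = L2_norm lborel (F f)"
    by (rule L2_norm_cong_AE) (use eq in \<open>auto elim: eventually_mono\<close>)
  then have "L2_norm lborel h \<le> sqrt (4 * pi) * L2_norm lborel f"
    using fourier_transform_bound[OF F f2] by simp
  then show thesis by (rule that[OF hL _ _ inv]) (auto simp: h_def)
qed

section \<open>Exponential sums over a Riesz-basis sequence\<close>

abbreviation fin_norm :: "int set \<Rightarrow> (int \<Rightarrow> complex) \<Rightarrow> real" where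
  "fin_norm J a \<equiv> L2_set (\<lambda>j. cmod (a j)) J"

definition expsum :: "(int \<Rightarrow> real) \<Rightarrow> int set \<Rightarrow> (int \<Rightarrow> complex) \<Rightarrow> real \<Rightarrow> complex" where
  "expsum x J a t = (\<Sum>j\<in>J. a j * exp (- \<i> * complex_of_real (x j * t)))"

lemma expsum_measurable [measurable]: "expsum x J a \<in> borel_measurable borel"
  unfolding expsum_def[abs_def] by measurable

lemma expsum_shift:
  "expsum x J a (s + t) = expsum x J (\<lambda>j. a j * exp (- \<i> * complex_of_real (x j * s))) t"
proof -
  have "exp (- \<i> * complex_of_real (x j * (s + t))) =
      exp (- \<i> * complex_of_real (x j * s)) * exp (- \<i> * complex_of_real (x j * t))" for j
    unfolding exp_add[symmetric] by (simp add: algebra_simps)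
  then show ?thesis unfolding expsum_def by (simp only: mult.assoc)
qed

lemma square_summable_finite:
  assumes "finite J"
  shows "square_summable (\<lambda>j. if j \<in> J then b j else 0)"
    and "l2_norm (\<lambda>j. if j \<in> J then b j else 0) = fin_norm J b"
proof -
  let ?c = "\<lambda>j. (cmod (if j \<in> J then b j else 0))\<^sup>2"
  have "?c summable_on J \<longleftrightarrow> ?c summable_on UNIV"
    by (rule summable_on_cong_neutral) auto
  then show "square_summable (\<lambda>j. if j \<in> J then b j else 0)"
    unfolding square_summable_def using assms by simp
  have "infsum ?c J = infsum ?c UNIV" by (rule infsum_cong_neutral) auto
  then show "l2_norm (\<lambda>j. if j \<in> J then b j else 0) = fin_norm J b"
    unfolding l2_norm_def L2_set_def using assms by simp
qed

text \<open>What a Riesz basis provides at the level of finite sums: two-sided norm bounds and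
  density of the span. A single constant \<open>B\<close> serves both bounds.\<close>

locale riesz_exponentials =
  fixes x :: "int \<Rightarrow> real" and B :: real
  assumes B_pos: "B > 0"
    and expsum_L2: "finite J \<Longrightarrow> expsum x J b \<in> L2 pi_interval"
    and lower: "finite J \<Longrightarrow> fin_norm J b \<le> B * L2_norm pi_interval (expsum x J b)"
    and upper: "finite J \<Longrightarrow> L2_norm pi_interval (expsum x J b) \<le> B * fin_norm J b"
    and dense: "u \<in> L2 pi_interval \<Longrightarrow> \<epsilon> > 0 \<Longrightarrow>
      \<exists>J b. finite J \<and> L2_norm pi_interval (\<lambda>t. u t - expsum x J b t) < \<epsilon>"

lemma riesz_basis_sequence_exponentials:
  assumes "riesz_basis_sequence x"
  obtains B where "riesz_exponentials x B"
proof -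
  define e where "e = (\<lambda>j t. exp (- \<i> * complex_of_real (x j * t)))"
  have rb: "riesz_basis pi_interval e"
    using assms by (simp add: riesz_basis_sequence_def e_def)
  obtain B where B: "B > 0" and Bc: "\<And>c. square_summable c \<Longrightarrow>
        (\<exists>h. has_L2_sum pi_interval (\<lambda>j t. c j * e j t) h \<and>
             inverse B * l2_norm c \<le> L2_norm pi_interval h \<and> L2_norm pi_interval h \<le> B * l2_norm c)"
    using rb by (auto simp: riesz_basis_def)
  have eL: "e j \<in> L2 pi_interval" for j using rb by (auto simp: riesz_basis_def)
  have sumL: "expsum x J b \<in> L2 pi_interval" if "finite J" for J b
    using L2_sum[of J "\<lambda>j t. b j * e j t"] L2_scale[OF eL]
    by (simp add: expsum_def[abs_def] e_def)
  have two: "inverse B * fin_norm J b \<le> L2_norm pi_interval (expsum x J b) \<and>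
      L2_norm pi_interval (expsum x J b) \<le> B * fin_norm J b" if J: "finite J" for J b
  proof -
    let ?c = "\<lambda>j. if j \<in> J then b j else 0"
    note c = square_summable_finite[OF J, of b]
    obtain h where h: "has_L2_sum pi_interval (\<lambda>j t. ?c j * e j t) h"
      and b: "inverse B * fin_norm J b \<le> L2_norm pi_interval h" "L2_norm pi_interval h \<le> B * fin_norm J b"
      using Bc[OF c(1)] unfolding c(2) by blast
    have hL: "h \<in> L2 pi_interval" using h by (simp add: has_L2_sum_def)
    \<comment> \<open>Once \<open>J'\<close> contains \<open>J\<close>, the partial sums of the
      zero-extended sequence no longer change. Hence the sum \<open>h\<close> supplied by the Riesz
      property is at L2 distance 0 from the finite sum and has the same norm.\<close>
    have ev: "\<forall>\<^sub>F J' in finite_subsets_at_top UNIV.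
        L2_norm pi_interval (\<lambda>t. h t - (\<Sum>j\<in>J'. ?c j * e j t)) =
        L2_norm pi_interval (\<lambda>t. h t - expsum x J b t)"
      unfolding eventually_finite_subsets_at_top
    proof (intro exI conjI allI impI)
      fix J' :: "int set" assume J': "finite J' \<and> J \<subseteq> J' \<and> J' \<subseteq> UNIV"
      have "(\<Sum>j\<in>J'. ?c j * e j t) = expsum x J b t" for t
        unfolding expsum_def e_def using J' by (intro sum.mono_neutral_cong_right) auto
      then show "L2_norm pi_interval (\<lambda>t. h t - (\<Sum>j\<in>J'. ?c j * e j t)) =
        L2_norm pi_interval (\<lambda>t. h t - expsum x J b t)" by simp
    qed (use J in auto)
    have "((\<lambda>J'. L2_norm pi_interval (\<lambda>t. h t - (\<Sum>j\<in>J'. ?c j * e j t))) \<longlongrightarrow> 0) (finite_subsets_at_top UNIV)"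
      using h by (simp add: has_L2_sum_def)
    then have "((\<lambda>_. L2_norm pi_interval (\<lambda>t. h t - expsum x J b t)) \<longlongrightarrow> 0) (finite_subsets_at_top (UNIV :: int set))"
      using tendsto_cong[OF ev] by blast
    then have z: "L2_norm pi_interval (\<lambda>t. h t - expsum x J b t) = 0"
      by (simp add: tendsto_const_iff)
    have "L2_norm pi_interval h = L2_norm pi_interval (expsum x J b)"
      using L2_norm_le_add_diff[OF hL sumL[OF J, of b]] L2_norm_le_add_diff[OF sumL[OF J, of b] hL] z
      by (simp add: L2_norm_minus_commute[of _ h])
    then show ?thesis using b by simp
  qed
  have "riesz_exponentials x B"
  proof
    show "B > 0" by (rule B)
    show "expsum x J b \<in> L2 pi_interval" if "finite J" for J b by (rule sumL[OF that])
    show "fin_norm J b \<le> B * L2_norm pi_interval (expsum x J b)" if "finite J" for J b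
      using two[OF that, of b] B by (simp add: field_simps)
    show "L2_norm pi_interval (expsum x J b) \<le> B * fin_norm J b" if "finite J" for J b
      using two[OF that, of b] by simp
    fix u and \<epsilon> :: real assume u: "u \<in> L2 pi_interval" and \<epsilon>: "\<epsilon> > 0"
    obtain a where "has_L2_sum pi_interval (\<lambda>j t. a j * e j t) u"
      using rb u unfolding riesz_basis_def by blast
    then have "((\<lambda>J. L2_norm pi_interval (\<lambda>t. u t - (\<Sum>j\<in>J. a j * e j t))) \<longlongrightarrow> 0) (finite_subsets_at_top UNIV)"
      by (simp add: has_L2_sum_def)
    then have "\<forall>\<^sub>F J in finite_subsets_at_top UNIV. L2_norm pi_interval (\<lambda>t. u t - (\<Sum>j\<in>J. a j * e j t)) < \<epsilon>"
      by (rule order_tendstoD(2)) (rule \<epsilon>)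
    then obtain J where "finite J" "L2_norm pi_interval (\<lambda>t. u t - (\<Sum>j\<in>J. a j * e j t)) < \<epsilon>"
      unfolding eventually_finite_subsets_at_top by blast
    then show "\<exists>J b. finite J \<and> L2_norm pi_interval (\<lambda>t. u t - expsum x J b t) < \<epsilon>"
      unfolding expsum_def e_def by blast
  qed
  then show thesis by (rule that)
qed

section \<open>Duality on [-pi, pi] and exponential sums on the whole line\<close>

lemma pi_interval_integral:
  fixes f :: "real \<Rightarrow> 'b::{banach, second_countable_topology}"
  shows "integral\<^sup>L pi_interval f = (\<integral>t. indicator {-pi..pi} t *\<^sub>R f t \<partial>lborel)"
  by (rule integral_restrict_space) simp

lemma pi_interval_integrable_iff:
  fixes f :: "real \<Rightarrow> 'b::{banach, second_countable_topology}"
  shows "integrable pi_interval f \<longleftrightarrow> integrable lborel (\<lambda>t. indicator {-pi..pi} t *\<^sub>R f t)"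
  by (rule integrable_restrict_space) simp

context riesz_exponentials
begin

text \<open>Let \<psi> be a finite exponential sum within \<epsilon> of \<open>u\<close>, and write
  the squared norm of \<open>u\<close> as <u, u - \<psi>> + <u, \<psi>>. The first term is small by
  Cauchy--Schwarz. In the second, the lower Riesz bound limits the coefficients of \<psi> by
  \<open>B\<close> times the norm of \<psi>, hence nearly by \<open>B\<close> times the norm of
  \<open>u\<close>.\<close>

lemma norm_le_dual_bound:
  assumes u: "u \<in> L2 pi_interval" and D: "D \<ge> 0"
    and dual: "\<And>J b. finite J \<Longrightarrow> cmod (\<integral>t. u t * cnj (expsum x J b t) \<partial>pi_interval) \<le> D * fin_norm J b"
  shows "L2_norm pi_interval u \<le> B * D"
proof -
  define N where "N = L2_norm pi_interval u"
  have N: "N \<ge> 0" by (simp add: N_def)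
  have le: "N\<^sup>2 \<le> N * \<epsilon> + D * (B * (N + \<epsilon>))" if \<epsilon>: "\<epsilon> > 0" for \<epsilon>
  proof -
    obtain J b where J: "finite J" and d: "L2_norm pi_interval (\<lambda>t. u t - expsum x J b t) < \<epsilon>"
      using dense[OF u \<epsilon>] by blast
    note E = expsum_L2[OF J, of b]
    have "fin_norm J b \<le> B * L2_norm pi_interval (expsum x J b)" by (rule lower[OF J])
    also have "\<dots> \<le> B * (N + \<epsilon>)"
      using L2_norm_le_add_diff[OF E u] d B_pos
      by (intro mult_left_mono) (auto simp: N_def L2_norm_minus_commute)
    finally have nb: "fin_norm J b \<le> B * (N + \<epsilon>)" .
    have cE: "(\<lambda>t. cnj (expsum x J b t)) \<in> L2 pi_interval" by (rule L2_cnj[OF E])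
    have cd: "(\<lambda>t. cnj (u t - expsum x J b t)) \<in> L2 pi_interval" by (rule L2_cnj[OF L2_diff[OF u E]])
    have "complex_of_real (N\<^sup>2) = (\<integral>t. u t * cnj (u t) \<partial>pi_interval)"
      unfolding N_def L2_norm_power2 by (simp flip: integral_complex_of_real complex_norm_square)
    also have "\<dots> = (\<integral>t. u t * cnj (u t - expsum x J b t) + u t * cnj (expsum x J b t) \<partial>pi_interval)"
      by (simp add: algebra_simps)
    also have "\<dots> = (\<integral>t. u t * cnj (u t - expsum x J b t) \<partial>pi_interval) +
        (\<integral>t. u t * cnj (expsum x J b t) \<partial>pi_interval)"
      by (rule Bochner_Integration.integral_add[OF L2_mult_integrable[OF u cd] L2_mult_integrable[OF u cE]])
    finally have "cmod (complex_of_real (N\<^sup>2)) \<le> cmod (\<integral>t. u t * cnj (u t - expsum x J b t) \<partial>pi_interval) +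
        cmod (\<integral>t. u t * cnj (expsum x J b t) \<partial>pi_interval)"
      by (simp only: norm_triangle_ineq)
    also have "\<dots> \<le> N * \<epsilon> + D * (B * (N + \<epsilon>))"
    proof (rule add_mono)
      have "cmod (\<integral>t. u t * cnj (u t - expsum x J b t) \<partial>pi_interval) \<le> N * L2_norm pi_interval (\<lambda>t. u t - expsum x J b t)"
        using L2_Cauchy_Schwarz[OF u cd] by (simp only: N_def L2_norm_cnj)
      also have "\<dots> \<le> N * \<epsilon>" using d N by (intro mult_left_mono) auto
      finally show "cmod (\<integral>t. u t * cnj (u t - expsum x J b t) \<partial>pi_interval) \<le> N * \<epsilon>" .
      show "cmod (\<integral>t. u t * cnj (expsum x J b t) \<partial>pi_interval) \<le> D * (B * (N + \<epsilon>))"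
        by (rule order_trans[OF dual[OF J] mult_left_mono[OF nb D]])
    qed
    finally show ?thesis by (simp only: norm_of_real abs_power2)
  qed
  have "N\<^sup>2 \<le> D * B * N"
  proof (rule field_le_epsilon)
    fix e :: real assume e: "e > 0"
    \<comment> \<open>The error terms add up to (N + D B) \<epsilon>; the extra 1 keeps the
      denominator positive.\<close>
    define \<epsilon> where "\<epsilon> = e / (N + D * B + 1)"
    have p: "N + D * B + 1 > 0" using N D B_pos by (simp add: add_nonneg_pos)
    have \<epsilon>: "\<epsilon> > 0" unfolding \<epsilon>_def using p e by (rule divide_pos_pos[rotated])
    have "(N + D * B) * \<epsilon> \<le> (N + D * B + 1) * \<epsilon>" using \<epsilon> by (intro mult_right_mono) auto
    also have "\<dots> = e" unfolding \<epsilon>_def using p by simp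
    finally show "N\<^sup>2 \<le> D * B * N + e" using le[OF \<epsilon>] by (simp add: algebra_simps)
  qed
  then have "N * N \<le> (B * D) * N" by (simp add: power2_eq_square mult_ac)
  then show ?thesis
    using N D B_pos unfolding N_def[symmetric] by (cases "N = 0") auto
qed

lemma window_bound:
  assumes J: "finite J"
  shows "(\<integral>\<^sup>+t. indicator {-pi..pi} (t - s) * ennreal ((cmod (expsum x J a t))\<^sup>2) \<partial>lborel)
    \<le> ennreal (B\<^sup>2 * (fin_norm J a)\<^sup>2)"
proof -
  define a' where "a' = (\<lambda>j. a j * exp (- \<i> * complex_of_real (x j * s)))"
  have n: "fin_norm J a' = fin_norm J a" by (simp add: a'_def norm_mult)
  have "(\<integral>\<^sup>+t. indicator {-pi..pi} (t - s) * ennreal ((cmod (expsum x J a t))\<^sup>2) \<partial>lborel)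
      = (\<integral>\<^sup>+t. indicator {-pi..pi} t * ennreal ((cmod (expsum x J a (s + t)))\<^sup>2) \<partial>lborel)"
    by (subst nn_integral_real_affine[where c=1 and t=s]) auto
  also have "\<dots> = (\<integral>\<^sup>+t. ennreal ((cmod (expsum x J a' t))\<^sup>2) \<partial>pi_interval)"
    by (subst nn_integral_restrict_space) (auto simp: expsum_shift a'_def mult.commute)
  also have "\<dots> = ennreal ((L2_norm pi_interval (expsum x J a'))\<^sup>2)"
    unfolding L2_norm_power2 by (rule nn_integral_eq_integral[OF L2_integrable[OF expsum_L2[OF J]]]) simp
  also have "\<dots> \<le> ennreal (B\<^sup>2 * (fin_norm J a)\<^sup>2)"
    using power_mono[OF upper[OF J, of a'], of 2] by (simp add: power_mult_distrib n ennreal_leI)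
  finally show ?thesis .
qed

end

text \<open>The integral over the line of the weight \<open>v\<close> in
  \<open>Gaussian_weighted_bound\<close>.\<close>

definition tail_const :: real where
  "tail_const = exp (pi\<^sup>2 / 2) * sqrt (8 * pi) / (2 * pi)"

lemma tail_const_pos: "tail_const > 0"
  by (simp add: tail_const_def)

text \<open>Obtained by integrating the window bound over all centres \<open>s\<close> against the weight \<open>v\<close>.\<close>

lemma (in riesz_exponentials) Gaussian_weighted_bound:
  assumes J: "finite J"
  shows "(\<integral>\<^sup>+t. ennreal (exp (- (t\<^sup>2 - pi\<^sup>2) / 4) * (cmod (expsum x J a t))\<^sup>2) \<partial>lborel)
    \<le> ennreal (tail_const * (B\<^sup>2 * (fin_norm J a)\<^sup>2))"
proof -
  \<comment> \<open>If |s - t| \<le> pi then s^2 \<le> 2 t^2 + 2 pi^2, so - (t^2 - pi^2) / 4 \<le>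
    pi^2 / 2 - s^2 / 8. Dividing by the window length 2 pi makes the integral of \<open>v\<close>
    over each window dominate the Gaussian weight at its centre.\<close>
  define v where "v = (\<lambda>s. exp (pi\<^sup>2 / 2) / (2 * pi) * exp (- (1 / 8) * s\<^sup>2))"
  define p where "p = (\<lambda>t. ennreal ((cmod (expsum x J a t))\<^sup>2))"
  have [measurable]: "p \<in> borel_measurable borel" "v \<in> borel_measurable borel"
    unfolding p_def v_def by measurable
  have [measurable]: "(\<lambda>z :: real \<times> real. indicator {-pi..pi} (fst z - snd z) :: ennreal) \<in> borel_measurable (lborel \<Otimes>\<^sub>M lborel)"
    by measurable
  have point: "ennreal (exp (- (t\<^sup>2 - pi\<^sup>2) / 4)) \<le> (\<integral>\<^sup>+s. indicator {-pi..pi} (t - s) * ennreal (v s) \<partial>lborel)" for t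
  proof -
    define w where "w = exp (- (t\<^sup>2 - pi\<^sup>2) / 4) / (2 * pi)"
    have w0: "w \<ge> 0" by (simp add: w_def)
    have ind: "indicator {-pi..pi} (t - s) = (indicator {t-pi..t+pi} s :: ennreal)" for s
      by (auto simp: indicator_def)
    have "ennreal (exp (- (t\<^sup>2 - pi\<^sup>2) / 4)) = ennreal (w * (2 * pi))" by (simp add: w_def)
    also have "\<dots> = ennreal w * emeasure lborel {t-pi..t+pi}"
      using w0 by (subst ennreal_mult) auto
    also have "\<dots> = (\<integral>\<^sup>+s. ennreal w * indicator {t-pi..t+pi} s \<partial>lborel)"
      by (rule nn_integral_cmult_indicator[symmetric]) simp
    also have "\<dots> \<le> (\<integral>\<^sup>+s. indicator {-pi..pi} (t - s) * ennreal (v s) \<partial>lborel)"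
      unfolding ind
    proof (intro nn_integral_mono)
      fix s
      have "w \<le> v s" if "s \<in> {t-pi..t+pi}"
      proof -
        have "\<bar>s - t\<bar> \<le> pi" using that by auto
        then have "(s - t)\<^sup>2 \<le> pi\<^sup>2" using abs_le_square_iff[of "s - t" pi] by simp
        \<comment> \<open>Parallelogram identity: s^2 + (2 t - s)^2 = 2 t^2 + 2 (s - t)^2.\<close>
        moreover have "(2 * t - s)\<^sup>2 \<ge> 0" by simp
        ultimately have "s\<^sup>2 \<le> 2 * t\<^sup>2 + 2 * pi\<^sup>2" by (simp add: power2_eq_square algebra_simps)
        then have "- (t\<^sup>2 - pi\<^sup>2) / 4 \<le> pi\<^sup>2 / 2 + (- (1 / 8) * s\<^sup>2)" by (simp add: field_simps)
        then have "exp (- (t\<^sup>2 - pi\<^sup>2) / 4) \<le> exp (pi\<^sup>2 / 2) * exp (- (1 / 8) * s\<^sup>2)"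
          by (simp only: exp_le_cancel_iff flip: exp_add)
        then show ?thesis unfolding w_def v_def by (simp add: divide_right_mono)
      qed
      then show "ennreal w * indicator {t-pi..t+pi} s \<le> indicator {t-pi..t+pi} s * ennreal (v s)"
        by (auto simp: indicator_def intro: ennreal_leI)
    qed
    finally show ?thesis .
  qed
  have v: "(\<integral>\<^sup>+s. ennreal (v s) \<partial>lborel) = ennreal tail_const"
  proof -
    have "has_bochner_integral lborel v (exp (pi\<^sup>2 / 2) / (2 * pi) * sqrt (pi / (1 / 8)))"
      unfolding v_def by (intro has_bochner_integral_mult_right Gaussian_integral) simp
    then show ?thesis
      by (subst nn_integral_eq_integral) (auto simp: has_bochner_integral_iff v_def tail_const_def mult.commute)
  qed
  have "(\<integral>\<^sup>+t. ennreal (exp (- (t\<^sup>2 - pi\<^sup>2) / 4) * (cmod (expsum x J a t))\<^sup>2) \<partial>lborel)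
      = (\<integral>\<^sup>+t. ennreal (exp (- (t\<^sup>2 - pi\<^sup>2) / 4)) * p t \<partial>lborel)"
    by (simp add: p_def ennreal_mult)
  also have "\<dots> \<le> (\<integral>\<^sup>+t. (\<integral>\<^sup>+s. indicator {-pi..pi} (t - s) * ennreal (v s) \<partial>lborel) * p t \<partial>lborel)"
    by (intro nn_integral_mono mult_right_mono point) auto
  also have "\<dots> = (\<integral>\<^sup>+t. \<integral>\<^sup>+s. ennreal (v s) * (indicator {-pi..pi} (t - s) * p t) \<partial>lborel \<partial>lborel)"
    by (subst nn_integral_multc[symmetric]) (auto simp: mult_ac)
  also have "\<dots> = (\<integral>\<^sup>+s. \<integral>\<^sup>+t. ennreal (v s) * (indicator {-pi..pi} (t - s) * p t) \<partial>lborel \<partial>lborel)"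
    by (rule lborel_pair.Fubini') measurable
  also have "\<dots> = (\<integral>\<^sup>+s. ennreal (v s) * (\<integral>\<^sup>+t. indicator {-pi..pi} (t - s) * p t \<partial>lborel) \<partial>lborel)"
    by (simp add: nn_integral_cmult)
  also have "\<dots> \<le> (\<integral>\<^sup>+s. ennreal (v s) * ennreal (B\<^sup>2 * (fin_norm J a)\<^sup>2) \<partial>lborel)"
    unfolding p_def by (intro nn_integral_mono mult_left_mono window_bound[OF J]) auto
  also have "\<dots> = ennreal (tail_const * (B\<^sup>2 * (fin_norm J a)\<^sup>2))"
    using tail_const_pos by (simp add: nn_integral_multc v ennreal_mult)
  finally show ?thesis .
qed

section \<open>Coercive kernels on square-summable sequences\<close>

lemma fin_norm_mono: "finite J' \<Longrightarrow> J \<subseteq> J' \<Longrightarrow> fin_norm J a \<le> fin_norm J' a"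
  unfolding L2_set_def by (intro real_sqrt_le_mono sum_mono2) auto

lemma fin_norm_triangle: "fin_norm J (\<lambda>j. a j + b j) \<le> fin_norm J a + fin_norm J b"
proof -
  have "fin_norm J (\<lambda>j. a j + b j) \<le> L2_set (\<lambda>j. cmod (a j) + cmod (b j)) J"
    by (rule L2_set_mono) (auto intro: norm_triangle_ineq)
  also have "\<dots> \<le> fin_norm J a + fin_norm J b" by (rule L2_set_triangle_ineq)
  finally show ?thesis .
qed

lemma fin_norm_Cauchy_Schwarz: "cmod (\<Sum>j\<in>J. a j * b j) \<le> fin_norm J a * fin_norm J b"
proof -
  have "cmod (\<Sum>j\<in>J. a j * b j) \<le> (\<Sum>j\<in>J. \<bar>cmod (a j)\<bar> * \<bar>cmod (b j)\<bar>)"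
    by (rule order_trans[OF norm_sum]) (simp add: norm_mult)
  also have "\<dots> \<le> fin_norm J a * fin_norm J b" by (rule L2_set_mult_ineq)
  finally show ?thesis .
qed

lemma fin_norm_power2: "(fin_norm J a)\<^sup>2 = (\<Sum>j\<in>J. (cmod (a j))\<^sup>2)"
  unfolding L2_set_def by (simp add: sum_nonneg)

lemma square_summableI:
  assumes "\<And>J. finite J \<Longrightarrow> fin_norm J a \<le> M"
  shows "square_summable a"
  unfolding square_summable_def
proof (rule nonneg_bdd_above_summable_on)
  show "bdd_above (sum (\<lambda>j. (cmod (a j))\<^sup>2) ` {F. F \<subseteq> UNIV \<and> finite F})"
  proof (rule bdd_aboveI2)
    fix F assume "F \<in> {F :: int set. F \<subseteq> UNIV \<and> finite F}"
    then have "(fin_norm F a)\<^sup>2 \<le> M\<^sup>2" using assms[of F] by (intro power_mono) auto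
    then show "(\<Sum>j\<in>F. (cmod (a j))\<^sup>2) \<le> M\<^sup>2" by (simp add: fin_norm_power2)
  qed
qed auto

lemma square_summable_bound:
  assumes "square_summable a" "finite J"
  shows "fin_norm J a \<le> l2_norm a"
  unfolding L2_set_def l2_norm_def
  by (intro real_sqrt_le_mono finite_sum_le_infsum) (use assms in \<open>auto simp: square_summable_def\<close>)

lemma square_summable_tail:
  assumes a: "square_summable a" and e: "e > 0"
  obtains J0 where "finite J0" "\<And>J. finite J \<Longrightarrow> J \<inter> J0 = {} \<Longrightarrow> fin_norm J a \<le> e"
proof -
  let ?f = "\<lambda>j. (cmod (a j))\<^sup>2"
  have sm: "?f summable_on UNIV" using a by (simp add: square_summable_def)
  then have "(sum ?f \<longlongrightarrow> infsum ?f UNIV) (finite_subsets_at_top UNIV)"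
    using has_sum_infsum unfolding has_sum_def by blast
  then have "\<forall>\<^sub>F J in finite_subsets_at_top UNIV. infsum ?f UNIV - e\<^sup>2 < sum ?f J"
    by (rule order_tendstoD(1)) (use e in simp)
  then obtain J0 where J0: "finite J0" "infsum ?f UNIV - e\<^sup>2 < sum ?f J0"
    unfolding eventually_finite_subsets_at_top by blast
  show thesis
  proof (rule that[OF J0(1)])
    fix J assume J: "finite J" "J \<inter> J0 = {}"
    have "sum ?f J + sum ?f J0 = sum ?f (J \<union> J0)"
      using J J0 by (subst sum.union_disjoint) auto
    also have "\<dots> \<le> infsum ?f UNIV"
      by (rule finite_sum_le_infsum) (use sm J J0 in auto)
    finally have "(fin_norm J a)\<^sup>2 \<le> e\<^sup>2" using J0(2) unfolding fin_norm_power2 by linarith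
    then show "fin_norm J a \<le> e" by (rule power2_le_imp_le) (use e in simp)
  qed
qed

lemma square_summable_add:
  assumes "square_summable a" "square_summable b"
  shows "square_summable (\<lambda>j. a j + b j)"
proof (rule square_summableI)
  fix J :: "int set" assume J: "finite J"
  show "fin_norm J (\<lambda>j. a j + b j) \<le> l2_norm a + l2_norm b"
    using fin_norm_triangle[of a b J] square_summable_bound[OF assms(1) J]
      square_summable_bound[OF assms(2) J] by linarith
qed

lemma square_summable_scale:
  assumes "square_summable a" shows "square_summable (\<lambda>j. \<gamma> * a j)"
  using assms unfolding square_summable_def norm_mult power_mult_distrib
  by (rule summable_on_cmult_right)

text \<open>Sesquilinear, with the conjugate on the test sequence \<open>b\<close>. Separate index
  sets allow a truncated solution to be tested against sequences supported anywhere.\<close>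

definition bilinear_sum :: "(int \<Rightarrow> int \<Rightarrow> real) \<Rightarrow> int set \<Rightarrow> (int \<Rightarrow> complex) \<Rightarrow> int set \<Rightarrow> (int \<Rightarrow> complex) \<Rightarrow> complex" where
  "bilinear_sum A J a J' b = (\<Sum>k\<in>J'. (\<Sum>j\<in>J. a j * complex_of_real (A k j)) * cnj (b k))"

text \<open>The Lax--Milgram setting on square-summable sequences, expressed through finite sections
  so that the infinite matrix need not be introduced as an operator. \<open>A\<close> is real, so
  symmetry makes the form Hermitian.\<close>

locale coercive_kernel =
  fixes A :: "int \<Rightarrow> int \<Rightarrow> real" and K c :: real
  assumes sym: "A k j = A j k"
    and K_nonneg: "K \<ge> 0" and c_pos: "c > 0"
    and bounded: "finite J \<Longrightarrow> finite J' \<Longrightarrow>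
      cmod (bilinear_sum A J a J' b) \<le> K * fin_norm J a * fin_norm J' b"
    and coercive: "finite J \<Longrightarrow> c * (fin_norm J a)\<^sup>2 \<le> Re (bilinear_sum A J a J a)"
begin

text \<open>Adding an index \<open>p\<close> amounts to a Schur complement: \<open>z\<close> is annihilated by all old equations, and
  coercivity makes its value in equation \<open>p\<close> nonzero.\<close>

lemma finite_system_solvable:
  assumes "finite J"
  shows "\<exists>a. (\<forall>j. j \<notin> J \<longrightarrow> a j = 0) \<and> (\<forall>k\<in>J. (\<Sum>j\<in>J. a j * complex_of_real (A k j)) = y k)"
  using assms
proof (induction J arbitrary: y)
  case (insert p J)
  let ?app = "\<lambda>J a k. \<Sum>j\<in>J. a j * complex_of_real (A k j)"
  obtain v where v: "\<And>j. j \<notin> J \<Longrightarrow> v j = 0" "\<And>k. k \<in> J \<Longrightarrow> ?app J v k = y k"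
    using insert.IH[of y] by blast
  obtain w where w: "\<And>j. j \<notin> J \<Longrightarrow> w j = 0" "\<And>k. k \<in> J \<Longrightarrow> ?app J w k = complex_of_real (A k p)"
    using insert.IH[of "\<lambda>k. complex_of_real (A k p)"] by blast
  define z where "z = (\<lambda>j. if j = p then 1 else - w j)"
  have app_insert: "?app (insert p J) b k = b p * complex_of_real (A k p) + ?app J b k" for b k
    using insert.hyps by simp
  have zJ: "?app J z k = - ?app J w k" for k
    unfolding sum_negf[symmetric] using insert.hyps by (intro sum.cong) (auto simp: z_def)
  have z0: "?app (insert p J) z k = 0" if "k \<in> J" for k
    unfolding app_insert zJ w(2)[OF that] by (simp add: z_def)
  have "bilinear_sum A (insert p J) z (insert p J) z = ?app (insert p J) z p"
    unfolding bilinear_sum_def using insert.hyps z0 by (subst sum.insert) (auto simp: z_def)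
  moreover have "c * (fin_norm (insert p J) z)\<^sup>2 > 0"
  proof -
    have "1 \<le> (fin_norm (insert p J) z)\<^sup>2"
      unfolding fin_norm_power2 using insert.hyps by (simp add: z_def sum_nonneg)
    then show ?thesis using c_pos by (intro mult_pos_pos) linarith+
  qed
  moreover have "c * (fin_norm (insert p J) z)\<^sup>2 \<le> Re (bilinear_sum A (insert p J) z (insert p J) z)"
    using insert.hyps by (intro coercive) simp
  ultimately have nz: "?app (insert p J) z p \<noteq> 0" by (metis not_less zero_complex.sel(1))
  \<comment> \<open>The multiple of \<open>z\<close> that repairs equation \<open>p\<close>; the
    equations in \<open>J\<close> are unaffected by \<open>z\<close>.\<close>
  define \<tau> where "\<tau> = (y p - ?app (insert p J) v p) / ?app (insert p J) z p"
  have lin: "?app I (\<lambda>j. v j + \<tau> * z j) k = ?app I v k + \<tau> * ?app I z k" for I k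
    by (simp add: sum.distrib sum_distrib_left algebra_simps)
  show ?case
  proof (intro exI[of _ "\<lambda>j. v j + \<tau> * z j"] conjI allI impI ballI)
    fix j assume "j \<notin> insert p J"
    then show "v j + \<tau> * z j = 0" using v(1) w(1) by (auto simp: z_def)
  next
    fix k assume k: "k \<in> insert p J"
    show "?app (insert p J) (\<lambda>j. v j + \<tau> * z j) k = y k"
    proof (cases "k = p")
      case True
      then show ?thesis unfolding lin using nz by (simp add: \<tau>_def del: sum.insert)
    next
      case False
      then have kJ: "k \<in> J" using k by simp
      have "v p = 0" using v(1) insert.hyps by simp
      then show ?thesis unfolding lin z0[OF kJ] app_insert[of v] using v(2)[OF kJ] by simp
    qed
  qed
qed auto

text \<open>The energies \<open>\<E> n\<close> of the solutions of the finite sections are bounded and increasing, and their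
  increments dominate the squared distances of the solutions.\<close>

lemma solution_exists:
  assumes y: "\<And>J. finite J \<Longrightarrow> fin_norm J y \<le> Y"
  shows "\<exists>a. square_summable a \<and> (\<forall>k. ((\<lambda>j. a j * complex_of_real (A k j)) has_sum y k) UNIV)"
proof -
  define I where "I = (\<lambda>n :: nat. {- int n..int n})"
  have fI [simp]: "finite (I n)" for n by (simp add: I_def)
  have I_mono: "I m \<subseteq> I n" if "m \<le> n" for m n using that by (auto simp: I_def)
  have "\<forall>n. \<exists>a. (\<forall>j. j \<notin> I n \<longrightarrow> a j = 0) \<and> (\<forall>k\<in>I n. (\<Sum>j\<in>I n. a j * complex_of_real (A k j)) = y k)"
    using finite_system_solvable[OF fI] by blast
  then obtain s where s0: "\<And>n j. j \<notin> I n \<Longrightarrow> s n j = 0"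
    and s: "\<And>n k. k \<in> I n \<Longrightarrow> (\<Sum>j\<in>I n. s n j * complex_of_real (A k j)) = y k"
    by metis
  have s_ext: "(\<Sum>j\<in>J. s n j * complex_of_real (A k j)) = y k" if "finite J" "I n \<subseteq> J" "k \<in> I n" for n J k
    using s[OF that(3)] sum.mono_neutral_left[OF that(1,2), of "\<lambda>j. s n j * complex_of_real (A k j)"] s0
    by (auto simp: DiffE)
  define \<E> where "\<E> = (\<lambda>n. Re (\<Sum>k\<in>I n. y k * cnj (s n k)))"
  have \<E>_ext: "(\<Sum>k\<in>J. y k * cnj (s n k)) = (\<Sum>k\<in>I n. y k * cnj (s n k))" if "finite J" "I n \<subseteq> J" for n J
    using that s0 by (intro sum.mono_neutral_right) auto
  have en: "c * (fin_norm (I n) (s n))\<^sup>2 \<le> \<E> n" for n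
    using coercive[OF fI[of n], of "s n"] s by (simp add: bilinear_sum_def \<E>_def)
  have Y0: "Y \<ge> 0" using y[of "{}"] by simp
  have \<E>_le: "\<E> n \<le> Y * fin_norm (I n) (s n)" for n
  proof -
    have "\<E> n \<le> cmod (\<Sum>k\<in>I n. y k * cnj (s n k))" unfolding \<E>_def by (rule complex_Re_le_cmod)
    also have "\<dots> \<le> fin_norm (I n) y * fin_norm (I n) (\<lambda>k. cnj (s n k))" by (rule fin_norm_Cauchy_Schwarz)
    also have "\<dots> \<le> Y * fin_norm (I n) (s n)" using y[of "I n"] by (simp add: mult_right_mono)
    finally show ?thesis .
  qed
  have sn: "fin_norm (I n) (s n) \<le> Y / c" for n
  proof (cases "fin_norm (I n) (s n) = 0")
    case False
    then have pos: "fin_norm (I n) (s n) > 0" using L2_set_nonneg less_eq_real_def by metis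
    have "(c * fin_norm (I n) (s n)) * fin_norm (I n) (s n) \<le> Y * fin_norm (I n) (s n)"
      using en[of n] \<E>_le[of n] by (simp add: power2_eq_square mult.assoc)
    then show ?thesis using pos c_pos by (simp add: field_simps)
  qed (use Y0 c_pos in simp)
  \<comment> \<open>Galerkin orthogonality. Expanding the form at the difference gives four terms.
    The one without \<open>s m\<close> is \<E> n. The other three have real part \<E> m with signs
    -, -, +, since \<open>s m\<close> vanishes off \<open>I m\<close>, both sequences solve the
    equations there, and the symmetry of \<open>A\<close> moves the matrix onto \<open>s n\<close>
    in the mixed term.\<close>
  have diff: "c * (fin_norm (I n) (\<lambda>j. s n j - s m j))\<^sup>2 \<le> \<E> n - \<E> m" if mn: "m \<le> n" for m n
  proof -
    note sub = I_mono[OF mn]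
    let ?d = "\<lambda>j. s n j - s m j"
    let ?m = "\<lambda>k. \<Sum>j\<in>I n. s m j * complex_of_real (A k j)"
    have "(\<Sum>j\<in>I n. ?d j * complex_of_real (A k j)) = y k - ?m k" if "k \<in> I n" for k
      using s[OF that] by (simp add: left_diff_distrib sum_subtractf)
    then have "bilinear_sum A (I n) ?d (I n) ?d = (\<Sum>k\<in>I n. (y k - ?m k) * cnj (?d k))"
      unfolding bilinear_sum_def by simp
    also have "\<dots> = (\<Sum>k\<in>I n. y k * cnj (s n k)) - (\<Sum>k\<in>I n. y k * cnj (s m k))
        - (\<Sum>k\<in>I n. ?m k * cnj (s n k)) + (\<Sum>k\<in>I n. ?m k * cnj (s m k))"
      by (simp add: algebra_simps sum.distrib sum_subtractf)
    also have "(\<Sum>k\<in>I n. y k * cnj (s m k)) = (\<Sum>k\<in>I m. y k * cnj (s m k))"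
      by (rule \<E>_ext[OF fI sub])
    also have "(\<Sum>k\<in>I n. ?m k * cnj (s m k)) = (\<Sum>k\<in>I m. y k * cnj (s m k))"
    proof -
      have "(\<Sum>k\<in>I n. ?m k * cnj (s m k)) = (\<Sum>k\<in>I m. ?m k * cnj (s m k))"
        using s0 sub by (intro sum.mono_neutral_right) auto
      also have "\<dots> = (\<Sum>k\<in>I m. y k * cnj (s m k))"
        by (intro sum.cong refl) (simp add: s_ext[OF fI sub])
      finally show ?thesis .
    qed
    also have "(\<Sum>k\<in>I n. ?m k * cnj (s n k)) = cnj (\<Sum>k\<in>I m. y k * cnj (s m k))"
    proof -
      have "(\<Sum>k\<in>I n. ?m k * cnj (s n k)) = (\<Sum>k\<in>I n. \<Sum>j\<in>I n. s m j * complex_of_real (A k j) * cnj (s n k))"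
        by (simp add: sum_distrib_right)
      also have "\<dots> = (\<Sum>j\<in>I n. \<Sum>k\<in>I n. s m j * complex_of_real (A k j) * cnj (s n k))"
        by (rule sum.swap)
      also have "\<dots> = (\<Sum>j\<in>I n. s m j * cnj (\<Sum>k\<in>I n. s n k * complex_of_real (A j k)))"
        unfolding cnj_sum sum_distrib_left
        by (intro sum.cong refl) (subst sym, simp add: mult_ac)
      also have "\<dots> = (\<Sum>j\<in>I n. s m j * cnj (y j))" by (intro sum.cong refl) (simp add: s)
      also have "\<dots> = (\<Sum>j\<in>I m. s m j * cnj (y j))"
        using s0 sub by (intro sum.mono_neutral_right) auto
      finally show ?thesis by (simp add: mult.commute)
    qed
    finally have "Re (bilinear_sum A (I n) ?d (I n) ?d) = \<E> n - \<E> m" by (simp add: \<E>_def)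
    then show ?thesis using coercive[OF fI[of n], of ?d] by simp
  qed
  have "incseq \<E>"
  proof (rule incseq_SucI)
    fix n
    have "0 \<le> c * (fin_norm (I (Suc n)) (\<lambda>j. s (Suc n) j - s n j))\<^sup>2" using c_pos by simp
    then show "\<E> n \<le> \<E> (Suc n)" using diff[of n "Suc n"] by linarith
  qed
  moreover have "\<E> n \<le> Y * (Y / c)" for n
    by (rule order_trans[OF \<E>_le mult_left_mono[OF sn Y0]])
  ultimately obtain L where "\<E> \<longlonglongrightarrow> L" using incseq_convergent by blast
  then have Cau: "Cauchy \<E>" by (intro convergent_Cauchy convergentI)
  \<comment> \<open>Coercivity turns the Cauchy property of the energies into one for the solutions,
    uniformly over \<open>J\<close>. This uniformity is what makes the coordinatewise limit
    \<open>a\<close> below a limit in the square-summable norm.\<close>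
  have tail: "\<exists>N. \<forall>m\<ge>N. \<forall>n\<ge>m. \<forall>J. finite J \<longrightarrow> fin_norm J (\<lambda>j. s n j - s m j) \<le> e" if e: "e > 0" for e
  proof -
    have "c * e\<^sup>2 > 0" using c_pos e by simp
    then obtain N where N: "\<And>m n. N \<le> m \<Longrightarrow> N \<le> n \<Longrightarrow> dist (\<E> m) (\<E> n) < c * e\<^sup>2"
      using Cau unfolding Cauchy_def by blast
    show ?thesis
    proof (intro exI allI impI)
      fix m n and J :: "int set" assume m: "N \<le> m" and n: "m \<le> n" and J: "finite J"
      have "c * (fin_norm (I n) (\<lambda>j. s n j - s m j))\<^sup>2 \<le> c * e\<^sup>2"
        using diff[OF n] N[of m n] m n by (auto simp: dist_real_def)
      then have "(fin_norm (I n) (\<lambda>j. s n j - s m j))\<^sup>2 \<le> e\<^sup>2"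
        using c_pos by simp
      then have le: "fin_norm (I n) (\<lambda>j. s n j - s m j) \<le> e"
        by (rule power2_le_imp_le) (use e in simp)
      have "fin_norm J (\<lambda>j. s n j - s m j) \<le> fin_norm (J \<union> I n) (\<lambda>j. s n j - s m j)"
        by (rule fin_norm_mono) (use J in auto)
      also have "\<dots> = fin_norm (I n) (\<lambda>j. s n j - s m j)"
        unfolding L2_set_def
        by (intro arg_cong[where f=sqrt] sum.mono_neutral_right) (use J s0 I_mono[OF n] in auto)
      finally show "fin_norm J (\<lambda>j. s n j - s m j) \<le> e" using le by simp
    qed
  qed
  have conv: "convergent (\<lambda>n. s n j)" for j
  proof (rule Cauchy_convergent, unfold Cauchy_altdef, intro allI impI)
    fix e :: real assume e: "e > 0"
    obtain N where N: "\<And>m n J. N \<le> m \<Longrightarrow> m \<le> n \<Longrightarrow> finite J \<Longrightarrow> fin_norm J (\<lambda>j. s n j - s m j) \<le> e / 2"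
      using tail[of "e / 2"] e by auto
    show "\<exists>N. \<forall>m\<ge>N. \<forall>n>m. dist (s m j) (s n j) < e"
    proof (intro exI allI impI)
      fix m n assume "N \<le> m" "m < n"
      then show "dist (s m j) (s n j) < e"
        using N[of m n "{j}"] e by (simp add: L2_set_def dist_norm norm_minus_commute)
    qed
  qed
  define a where "a = (\<lambda>j. lim (\<lambda>n. s n j))"
  have a: "(\<lambda>n. s n j) \<longlonglongrightarrow> a j" for j
    unfolding a_def using conv by (simp add: convergent_LIMSEQ_iff)
  have atail: "\<exists>N. \<forall>m\<ge>N. \<forall>J. finite J \<longrightarrow> fin_norm J (\<lambda>j. a j - s m j) \<le> e" if e: "e > 0" for e
  proof -
    obtain N where N: "\<And>m n J. N \<le> m \<Longrightarrow> m \<le> n \<Longrightarrow> finite J \<Longrightarrow> fin_norm J (\<lambda>j. s n j - s m j) \<le> e"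
      using tail[OF e] by auto
    show ?thesis
    proof (intro exI allI impI)
      fix m and J :: "int set" assume m: "N \<le> m" and J: "finite J"
      have "(\<lambda>n. fin_norm J (\<lambda>j. s n j - s m j)) \<longlonglongrightarrow> fin_norm J (\<lambda>j. a j - s m j)"
        unfolding L2_set_def by (intro tendsto_intros a)
      then show "fin_norm J (\<lambda>j. a j - s m j) \<le> e"
        by (rule LIMSEQ_le_const2) (use N[OF m _ J] in auto)
    qed
  qed
  show ?thesis
  proof (intro exI conjI allI)
    obtain N where N: "\<And>J. finite J \<Longrightarrow> fin_norm J (\<lambda>j. a j - s N j) \<le> 1"
      using atail[of 1] by auto
    show "square_summable a"
    proof (rule square_summableI)
      fix J :: "int set" assume J: "finite J"
      have "fin_norm J a \<le> fin_norm J (\<lambda>j. a j - s N j) + fin_norm J (s N)"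
        using fin_norm_triangle[of "\<lambda>j. a j - s N j" "s N" J] by simp
      also have "fin_norm J (s N) \<le> fin_norm (J \<union> I N) (s N)" by (rule fin_norm_mono) (use J in auto)
      also have "fin_norm (J \<union> I N) (s N) = fin_norm (I N) (s N)"
        unfolding L2_set_def
        by (intro arg_cong[where f=sqrt] sum.mono_neutral_right) (use J s0 in auto)
      also have "\<dots> \<le> Y / c" by (rule sn)
      finally show "fin_norm J a \<le> 1 + Y / c" using N[OF J] by simp
    qed
    fix k
    show "((\<lambda>j. a j * complex_of_real (A k j)) has_sum y k) UNIV"
      unfolding has_sum_def tendsto_iff
    proof (intro allI impI)
      fix e :: real assume e: "e > 0"
      define e' where "e' = e / (K + 1)"
      have e': "e' > 0" using e K_nonneg by (simp add: e'_def)
      have Ke: "K * e' < e" using e K_nonneg by (simp add: e'_def field_simps)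
      obtain N where N: "\<And>m J. N \<le> m \<Longrightarrow> finite J \<Longrightarrow> fin_norm J (\<lambda>j. a j - s m j) \<le> e'"
        using atail[OF e'] by auto
      define m where "m = max N (nat \<bar>k\<bar>)"
      have km: "k \<in> I m" by (auto simp: m_def I_def)
      show "\<forall>\<^sub>F J in finite_subsets_at_top UNIV. dist (\<Sum>j\<in>J. a j * complex_of_real (A k j)) (y k) < e"
        unfolding eventually_finite_subsets_at_top
      proof (intro exI conjI allI impI)
        fix J :: "int set" assume J: "finite J \<and> I m \<subseteq> J \<and> J \<subseteq> UNIV"
        let ?d = "\<lambda>j. a j - s m j"
        \<comment> \<open>Since \<open>k\<close> lies in \<open>I m\<close> and \<open>J\<close>
          contains \<open>I m\<close>, \<open>s m\<close> solves equation \<open>k\<close> exactly.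
          The error is thus the form of \<open>a - s m\<close> tested with the unit vector at
          \<open>k\<close>, and boundedness of the form applies.\<close>
        have "(\<Sum>j\<in>J. a j * complex_of_real (A k j)) - y k = bilinear_sum A J ?d {k} (\<lambda>_. 1)"
          using s_ext[OF _ _ km, of J] J by (simp add: bilinear_sum_def left_diff_distrib sum_subtractf)
        then have "dist (\<Sum>j\<in>J. a j * complex_of_real (A k j)) (y k) \<le> K * fin_norm J ?d"
          using bounded[of J "{k}" ?d "\<lambda>_. 1"] J by (simp add: dist_norm L2_set_def)
        also have "\<dots> \<le> K * e'"
          using N[of m J] J K_nonneg by (intro mult_left_mono) (auto simp: m_def)
        finally show "dist (\<Sum>j\<in>J. a j * complex_of_real (A k j)) (y k) < e" using Ke by simp
      qed auto
    qed
  qed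
qed

text \<open>The full solution paired with \<open>b\<close> gives the samples paired with
  \<open>b\<close>, at most \<open>Y * fin_norm J' b\<close>. The part of \<open>a\<close> outside
  \<open>J0\<close> is small in norm, so by boundedness of the form cutting it off costs at most
  \<open>e * fin_norm J' b\<close>. The set \<open>J0\<close> is chosen before \<open>b\<close> and
  \<open>J'\<close>, so one truncation serves all tests.\<close>

lemma truncation_bound:
  assumes a: "square_summable a" and sol: "\<And>k. ((\<lambda>j. a j * complex_of_real (A k j)) has_sum y k) UNIV"
    and y: "\<And>J. finite J \<Longrightarrow> fin_norm J y \<le> Y" and e: "e > 0"
  obtains J0 where "finite J0"
    "\<And>J J' b. finite J \<Longrightarrow> J0 \<subseteq> J \<Longrightarrow> finite J' \<Longrightarrow> cmod (bilinear_sum A J a J' b) \<le> (Y + e) * fin_norm J' b"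
proof -
  \<comment> \<open>The denominator \<open>K + 1\<close> stays positive when \<open>K = 0\<close>,
    and still gives K e' \<le> e.\<close>
  define e' where "e' = e / (K + 1)"
  have e': "e' > 0" using e K_nonneg by (simp add: e'_def)
  have Ke: "K * e' \<le> e" using e K_nonneg by (simp add: e'_def field_simps)
  obtain J0 where J0: "finite J0" "\<And>J. finite J \<Longrightarrow> J \<inter> J0 = {} \<Longrightarrow> fin_norm J a \<le> e'"
    using square_summable_tail[OF a e'] by blast
  show thesis
  proof (rule that[OF J0(1)])
    fix J J' b assume J: "finite J" "J0 \<subseteq> J" and J': "finite (J' :: int set)"
    have "((\<lambda>J''. cmod (bilinear_sum A J'' a J' b) + e * fin_norm J' b) \<longlongrightarrow>
        cmod (\<Sum>k\<in>J'. y k * cnj (b k)) + e * fin_norm J' b) (finite_subsets_at_top UNIV)"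
      unfolding bilinear_sum_def
      by (intro tendsto_intros) (use sol in \<open>simp add: has_sum_def\<close>)
    moreover have "\<forall>\<^sub>F J'' in finite_subsets_at_top UNIV.
        cmod (bilinear_sum A J a J' b) \<le> cmod (bilinear_sum A J'' a J' b) + e * fin_norm J' b"
      unfolding eventually_finite_subsets_at_top
    proof (intro exI conjI allI impI)
      fix J'' assume J'': "finite J'' \<and> J \<subseteq> J'' \<and> J'' \<subseteq> UNIV"
      have split: "(\<Sum>j\<in>J''. f j) = (\<Sum>j\<in>J. f j) + (\<Sum>j\<in>J''-J. f j)" for f :: "int \<Rightarrow> complex"
        using J'' sum.subset_diff[of J J'' f] by (simp add: add.commute)
      have "bilinear_sum A J'' a J' b = bilinear_sum A J a J' b + bilinear_sum A (J'' - J) a J' b"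
        unfolding bilinear_sum_def split[of "\<lambda>j. a j * complex_of_real (A _ j)"]
        by (simp add: distrib_right sum.distrib)
      then have "cmod (bilinear_sum A J a J' b) \<le> cmod (bilinear_sum A J'' a J' b) + cmod (bilinear_sum A (J'' - J) a J' b)"
        by (metis add_diff_cancel_right' norm_triangle_ineq4)
      also have "cmod (bilinear_sum A (J'' - J) a J' b) \<le> K * fin_norm (J'' - J) a * fin_norm J' b"
        using J'' J' by (intro bounded) auto
      also have "\<dots> \<le> K * e' * fin_norm J' b"
        using J0(2)[of "J'' - J"] J J'' K_nonneg by (intro mult_right_mono mult_left_mono) auto
      also have "\<dots> \<le> e * fin_norm J' b" using Ke by (rule mult_right_mono) simp
      finally show "cmod (bilinear_sum A J a J' b) \<le> cmod (bilinear_sum A J'' a J' b) + e * fin_norm J' b"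
        by simp
    qed (use J in auto)
    ultimately have "cmod (bilinear_sum A J a J' b) \<le> cmod (\<Sum>k\<in>J'. y k * cnj (b k)) + e * fin_norm J' b"
      by (rule tendsto_lowerbound) simp
    also have "cmod (\<Sum>k\<in>J'. y k * cnj (b k)) \<le> Y * fin_norm J' b"
      using order_trans[OF fin_norm_Cauchy_Schwarz[of y "\<lambda>k. cnj (b k)" J'] mult_right_mono[OF y[OF J']]] by simp
    finally show "cmod (bilinear_sum A J a J' b) \<le> (Y + e) * fin_norm J' b"
      by (simp add: distrib_right)
  qed
qed

text \<open>With \<open>Y = 0\<close> and tolerance \<open>c * e\<close>, a large truncation tested
  against itself satisfies c N^2 \<le> c e N for its norm N, so each entry is at most
  \<open>e\<close>.\<close>

lemma homogeneous_solution_zero: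
  assumes a: "square_summable a" and sol: "\<And>k. ((\<lambda>j. a j * complex_of_real (A k j)) has_sum 0) UNIV"
  shows "a i = 0"
proof -
  have "cmod (a i) \<le> 0"
  proof (rule field_le_epsilon)
    fix e :: real assume e: "e > 0"
    have z: "fin_norm J (\<lambda>_. 0) \<le> 0" for J by (simp add: L2_set_def)
    have ce: "c * e > 0" using c_pos e by simp
    obtain J0 where J0: "finite J0"
      "\<And>J J' b. finite J \<Longrightarrow> J0 \<subseteq> J \<Longrightarrow> finite J' \<Longrightarrow> cmod (bilinear_sum A J a J' b) \<le> (0 + c * e) * fin_norm J' b"
      by (rule truncation_bound[OF a sol z ce]) (rule that)
    define J where "J = insert i J0"
    have J: "finite J" "J0 \<subseteq> J" using J0 by (auto simp: J_def)
    define N where "N = fin_norm J a"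
    have N0: "N \<ge> 0" by (simp add: N_def)
    have "c * N\<^sup>2 \<le> Re (bilinear_sum A J a J a)" unfolding N_def by (rule coercive[OF J(1)])
    also have "\<dots> \<le> cmod (bilinear_sum A J a J a)" by (rule complex_Re_le_cmod)
    also have "\<dots> \<le> c * e * N" using J0(2)[OF J J(1), of a] by (simp add: N_def)
    finally have "N * N \<le> e * N" using c_pos by (simp add: power2_eq_square mult.assoc)
    then have "N \<le> e" using N0 e by (cases "N = 0") auto
    moreover have "cmod (a i) = fin_norm {i} a" by (simp add: L2_set_def)
    moreover have "fin_norm {i} a \<le> N" unfolding N_def by (rule fin_norm_mono) (use J in \<open>auto simp: J_def\<close>)
    ultimately show "cmod (a i) \<le> 0 + e" by simp
  qed
  then show ?thesis by simp
qed

lemma solution_unique: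
  assumes "square_summable a" "\<And>k. ((\<lambda>j. a j * complex_of_real (A k j)) has_sum y k) UNIV"
    and "square_summable b" "\<And>k. ((\<lambda>j. b j * complex_of_real (A k j)) has_sum y k) UNIV"
  shows "a = b"
proof
  fix i
  have "a i + (- 1) * b i = 0"
  proof (rule homogeneous_solution_zero)
    show "square_summable (\<lambda>j. a j + (- 1) * b j)"
      by (intro square_summable_add square_summable_scale assms)
    show "((\<lambda>j. (a j + (- 1) * b j) * complex_of_real (A k j)) has_sum 0) UNIV" for k
      using has_sum_add[OF assms(2)[of k] has_sum_cmult_right[OF assms(4)[of k], of "- 1"]]
      by (simp add: algebra_simps)
  qed
  then show "a i = b i" by simp
qed

end

section \<open>Stability of finite Gaussian sums\<close>

text \<open>The density called G in the overview: centred normal with variance 2 \<mu>.\<close>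

definition freq_weight :: "real \<Rightarrow> real \<Rightarrow> real" where
  "freq_weight \<mu> t = exp (- t\<^sup>2 / (4 * \<mu>)) / sqrt (4 * pi * \<mu>)"

lemma freq_weight_measurable [measurable]: "freq_weight \<mu> \<in> borel_measurable borel"
  unfolding freq_weight_def by measurable

lemma freq_weight_pos: "\<mu> > 0 \<Longrightarrow> freq_weight \<mu> t > 0"
  by (simp add: freq_weight_def)

lemma freq_weight_antimono:
  assumes "\<mu> > 0" "\<bar>s\<bar> \<le> \<bar>t\<bar>"
  shows "freq_weight \<mu> t \<le> freq_weight \<mu> s"
proof -
  have "s\<^sup>2 \<le> t\<^sup>2" using assms by (simp add: abs_le_square_iff)
  then show ?thesis
    using assms unfolding freq_weight_def by (intro divide_right_mono) (auto intro: divide_right_mono)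
qed

text \<open>The only place where \<open>\<mu> \<le> 1\<close> enters: relative to its value at \<open>pi\<close>, the weight is dominated
  outside \<open>[-pi, pi]\<close> by the one for \<open>\<mu> = 1\<close>.\<close>

lemma freq_weight_tail:
  assumes \<mu>: "0 < \<mu>" "\<mu> \<le> 1" and t: "pi \<le> \<bar>t\<bar>"
  shows "freq_weight \<mu> t \<le> freq_weight \<mu> pi * exp (- (t\<^sup>2 - pi\<^sup>2) / 4)"
proof -
  have "pi\<^sup>2 \<le> t\<^sup>2" using t by (simp add: abs_le_square_iff[symmetric])
  then have "(t\<^sup>2 - pi\<^sup>2) / 4 \<le> (t\<^sup>2 - pi\<^sup>2) / (4 * \<mu>)"
    using \<mu> by (intro divide_left_mono) auto
  then have "- t\<^sup>2 / (4 * \<mu>) \<le> - pi\<^sup>2 / (4 * \<mu>) + - (t\<^sup>2 - pi\<^sup>2) / 4"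
    by (simp add: diff_divide_distrib)
  then have "exp (- t\<^sup>2 / (4 * \<mu>)) \<le> exp (- pi\<^sup>2 / (4 * \<mu>)) * exp (- (t\<^sup>2 - pi\<^sup>2) / 4)"
    by (simp only: exp_le_cancel_iff flip: exp_add)
  then show ?thesis
    unfolding freq_weight_def times_divide_eq_left using \<mu> by (intro divide_right_mono) auto
qed

text \<open>A Gaussian majorant on the whole line. Its constant \<open>freq_weight \<mu> 0\<close>
  blows up as \<mu> tends to 0, so it serves qualitative facts for fixed \<mu>: boundedness of the
  form, integrability and pointwise convergence. The uniform estimate takes its constants from
  \<open>freq_weight_tail\<close>.\<close>

lemma freq_weight_le:
  assumes \<mu>: "0 < \<mu>" "\<mu> \<le> 1"
  shows "freq_weight \<mu> t \<le> freq_weight \<mu> 0 * exp (- (t\<^sup>2 - pi\<^sup>2) / 4)"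
proof (cases "pi \<le> \<bar>t\<bar>")
  case True
  have "freq_weight \<mu> pi * exp (- (t\<^sup>2 - pi\<^sup>2) / 4) \<le> freq_weight \<mu> 0 * exp (- (t\<^sup>2 - pi\<^sup>2) / 4)"
    by (rule mult_right_mono) (use freq_weight_antimono[OF \<mu>(1), of 0 pi] in auto)
  then show ?thesis using freq_weight_tail[OF \<mu> True] by linarith
next
  case False
  then have "t\<^sup>2 \<le> pi\<^sup>2" by (simp add: abs_le_square_iff[symmetric])
  then have "1 \<le> exp (- (t\<^sup>2 - pi\<^sup>2) / 4)" by simp
  then have "freq_weight \<mu> 0 * 1 \<le> freq_weight \<mu> 0 * exp (- (t\<^sup>2 - pi\<^sup>2) / 4)"
    using freq_weight_pos[OF \<mu>(1), of 0] by (intro mult_left_mono) auto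
  then show ?thesis using freq_weight_antimono[OF \<mu>(1), of 0 t] by simp
qed

section \<open>Gaussian sums and their quadratic form on the frequency side\<close>

lemma freq_weight_fourier:
  assumes \<mu>: "\<mu> > 0"
  shows "has_bochner_integral lborel
    (\<lambda>u. complex_of_real (freq_weight \<mu> u) * exp (\<i> * complex_of_real (u * t)))
    (complex_of_real (exp (- \<mu> * t\<^sup>2)))"
proof -
  let ?r = "complex_of_real (1 / sqrt (4 * pi * \<mu>))"
  have "has_bochner_integral lborel
    (\<lambda>u. ?r * (complex_of_real (exp (- (1 / (4 * \<mu>)) * u\<^sup>2)) * exp (\<i> * complex_of_real (u * t))))
    (?r * complex_of_real (sqrt (pi / (1 / (4 * \<mu>))) * exp (- t\<^sup>2 / (4 * (1 / (4 * \<mu>))))))"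
    by (intro has_bochner_integral_mult_right Gaussian_fourier) (use \<mu> in simp)
  moreover have "?r * (complex_of_real (exp (- (1 / (4 * \<mu>)) * u\<^sup>2)) * exp (\<i> * complex_of_real (u * t))) =
      complex_of_real (freq_weight \<mu> u) * exp (\<i> * complex_of_real (u * t))" for u
    by (simp add: freq_weight_def)
  moreover have "?r * complex_of_real (sqrt (pi / (1 / (4 * \<mu>))) * exp (- t\<^sup>2 / (4 * (1 / (4 * \<mu>))))) =
      complex_of_real (exp (- \<mu> * t\<^sup>2))"
  proof -
    have a: "sqrt (pi / (1 / (4 * \<mu>))) = sqrt (4 * pi * \<mu>)" by (simp add: mult_ac)
    have b: "- t\<^sup>2 / (4 * (1 / (4 * \<mu>))) = - \<mu> * t\<^sup>2" by simp
    have "sqrt (4 * pi * \<mu>) \<noteq> 0" using \<mu> by simp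
    then show ?thesis unfolding of_real_mult[symmetric] a b by simp
  qed
  ultimately show ?thesis by simp
qed

definition gaussian_sum :: "real \<Rightarrow> (int \<Rightarrow> real) \<Rightarrow> int set \<Rightarrow> (int \<Rightarrow> complex) \<Rightarrow> real \<Rightarrow> complex" where
  "gaussian_sum \<mu> x J a t = (\<Sum>j\<in>J. a j * complex_of_real (exp (- \<mu> * (t - x j)\<^sup>2)))"

lemma gaussian_sum_fourier:
  assumes \<mu>: "\<mu> > 0"
  shows "has_bochner_integral lborel
    (\<lambda>u. complex_of_real (freq_weight \<mu> u) * expsum x J a u * exp (\<i> * complex_of_real (u * t)))
    (gaussian_sum \<mu> x J a t)"
proof -
  have "has_bochner_integral lborel
    (\<lambda>u. \<Sum>j\<in>J. a j * (complex_of_real (freq_weight \<mu> u) * exp (\<i> * complex_of_real (u * (t - x j)))))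
    (gaussian_sum \<mu> x J a t)"
    unfolding gaussian_sum_def
    by (intro has_bochner_integral_sum has_bochner_integral_mult_right freq_weight_fourier \<mu>)
  moreover have "(\<Sum>j\<in>J. a j * (complex_of_real (freq_weight \<mu> u) * exp (\<i> * complex_of_real (u * (t - x j))))) =
      complex_of_real (freq_weight \<mu> u) * expsum x J a u * exp (\<i> * complex_of_real (u * t))" for u
  proof -
    have "exp (\<i> * complex_of_real (u * (t - x j))) =
        exp (- \<i> * complex_of_real (x j * u)) * exp (\<i> * complex_of_real (u * t))" for j
      unfolding exp_add[symmetric] by (simp add: algebra_simps)
    then show ?thesis
      unfolding expsum_def sum_distrib_left sum_distrib_right by (simp only: mult_ac)
  qed
  ultimately show ?thesis by simp
qed

abbreviation gaussian_kernel :: "real \<Rightarrow> (int \<Rightarrow> real) \<Rightarrow> int \<Rightarrow> int \<Rightarrow> real" where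
  "gaussian_kernel \<mu> x k j \<equiv> exp (- \<mu> * (x k - x j)\<^sup>2)"

lemma cnj_expsum: "cnj (expsum x J b u) = (\<Sum>k\<in>J. cnj (b k) * exp (\<i> * complex_of_real (u * x k)))"
  by (simp add: expsum_def exp_cnj mult.commute)

lemma bilinear_sum_gaussian:
  assumes \<mu>: "\<mu> > 0"
  shows "bilinear_sum (gaussian_kernel \<mu> x) J a J' b =
    (\<integral>u. complex_of_real (freq_weight \<mu> u) * (expsum x J a u * cnj (expsum x J' b u)) \<partial>lborel)"
proof -
  have "has_bochner_integral lborel
    (\<lambda>u. \<Sum>k\<in>J'. (complex_of_real (freq_weight \<mu> u) * expsum x J a u * exp (\<i> * complex_of_real (u * x k))) * cnj (b k))
    (\<Sum>k\<in>J'. gaussian_sum \<mu> x J a (x k) * cnj (b k))"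
    by (intro has_bochner_integral_sum has_bochner_integral_mult_left gaussian_sum_fourier \<mu>)
  then have "(\<integral>u. (\<Sum>k\<in>J'. (complex_of_real (freq_weight \<mu> u) * expsum x J a u * exp (\<i> * complex_of_real (u * x k))) * cnj (b k)) \<partial>lborel)
      = (\<Sum>k\<in>J'. gaussian_sum \<mu> x J a (x k) * cnj (b k))"
    by (rule has_bochner_integral_integral_eq)
  moreover have "(\<Sum>k\<in>J'. (complex_of_real (freq_weight \<mu> u) * expsum x J a u * exp (\<i> * complex_of_real (u * x k))) * cnj (b k))
     = complex_of_real (freq_weight \<mu> u) * (expsum x J a u * cnj (expsum x J' b u))" for u
    unfolding cnj_expsum sum_distrib_left by (simp only: mult_ac)
  ultimately show ?thesis by (simp add: bilinear_sum_def gaussian_sum_def)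
qed

text \<open>An inverse transform is the conjugate of the Fourier integral of the conjugate, so the
  bound for \<open>fourier_integral\<close> applies to it.\<close>

lemma gaussian_sum_L2_norm:
  assumes \<mu>: "\<mu> > 0" and h: "(\<lambda>u. complex_of_real (freq_weight \<mu> u) * expsum x J a u) \<in> L2 lborel"
  shows "gaussian_sum \<mu> x J a \<in> L2 lborel"
    and "L2_norm lborel (gaussian_sum \<mu> x J a)
      \<le> sqrt (4 * pi) * L2_norm lborel (\<lambda>u. complex_of_real (freq_weight \<mu> u) * expsum x J a u)"
proof -
  define g where "g = (\<lambda>u. cnj (complex_of_real (freq_weight \<mu> u) * expsum x J a u))"
  have gL: "g \<in> L2 lborel" unfolding g_def by (rule L2_cnj[OF h])
  have "integrable lborel (\<lambda>u. complex_of_real (freq_weight \<mu> u) * expsum x J a u)"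
    using gaussian_sum_fourier[OF \<mu>, of x J a 0] by (simp add: has_bochner_integral_iff)
  then have gi: "integrable lborel g" unfolding g_def by (rule integrable_bounded_linear[OF bounded_linear_cnj])
  have eq: "gaussian_sum \<mu> x J a = (\<lambda>t. cnj (fourier_integral g t))"
  proof
    fix t
    have "gaussian_sum \<mu> x J a t =
      (\<integral>u. complex_of_real (freq_weight \<mu> u) * expsum x J a u * exp (\<i> * complex_of_real (u * t)) \<partial>lborel)"
      using has_bochner_integral_integral_eq[OF gaussian_sum_fourier[OF \<mu>]] by simp
    also have "\<dots> = (\<integral>u. cnj (g u * exp (- \<i> * complex_of_real (t * u))) \<partial>lborel)"
      by (simp add: g_def exp_cnj mult.commute)
    also have "\<dots> = cnj (fourier_integral g t)"
      unfolding fourier_integral_def by (rule Bochner_Integration.integral_cnj)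
    finally show "gaussian_sum \<mu> x J a t = cnj (fourier_integral g t)" .
  qed
  show "gaussian_sum \<mu> x J a \<in> L2 lborel"
    unfolding eq by (rule L2_cnj[OF fourier_integral_L2(1)[OF gi gL]])
  have "L2_norm lborel g = L2_norm lborel (\<lambda>u. complex_of_real (freq_weight \<mu> u) * expsum x J a u)"
    unfolding g_def by (rule L2_norm_cnj)
  then show "L2_norm lborel (gaussian_sum \<mu> x J a)
      \<le> sqrt (4 * pi) * L2_norm lborel (\<lambda>u. complex_of_real (freq_weight \<mu> u) * expsum x J a u)"
    using fourier_integral_L2(2)[OF gi gL] by (simp only: eq L2_norm_cnj)
qed

section \<open>Weighted estimates from the Riesz bounds, and uniform stability\<close>

context riesz_exponentials
begin

text \<open>The square root of the weight goes with each exponential sum so that Cauchy--Schwarz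
  handles the pairing that follows. Three weights occur later: G itself, G restricted to the outside
  of [-pi, pi], and the latter multiplied by G(pi).\<close>

lemma weighted_expsum_L2:
  assumes J: "finite J" and [measurable]: "\<omega> \<in> borel_measurable borel"
    and \<omega>: "\<And>t. 0 \<le> \<omega> t" "\<And>t. \<omega> t \<le> M * exp (- (t\<^sup>2 - pi\<^sup>2) / 4)" and M: "M \<ge> 0"
  shows "(\<lambda>t. complex_of_real (sqrt (\<omega> t)) * expsum x J a t) \<in> L2 lborel"
    and "(L2_norm lborel (\<lambda>t. complex_of_real (sqrt (\<omega> t)) * expsum x J a t))\<^sup>2
      \<le> M * (tail_const * (B\<^sup>2 * (fin_norm J a)\<^sup>2))"
proof -
  let ?f = "\<lambda>t. complex_of_real (sqrt (\<omega> t)) * expsum x J a t"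
  have sq: "(cmod (?f t))\<^sup>2 = \<omega> t * (cmod (expsum x J a t))\<^sup>2" for t
    using \<omega>(1) by (simp add: norm_mult power_mult_distrib)
  have "(\<integral>\<^sup>+t. ennreal ((cmod (?f t))\<^sup>2) \<partial>lborel) \<le>
      (\<integral>\<^sup>+t. ennreal M * ennreal (exp (- (t\<^sup>2 - pi\<^sup>2) / 4) * (cmod (expsum x J a t))\<^sup>2) \<partial>lborel)"
  proof (intro nn_integral_mono)
    fix t
    have "(cmod (?f t))\<^sup>2 \<le> M * (exp (- (t\<^sup>2 - pi\<^sup>2) / 4) * (cmod (expsum x J a t))\<^sup>2)"
      unfolding sq using mult_right_mono[OF \<omega>(2), of "(cmod (expsum x J a t))\<^sup>2" t] by (simp add: mult.assoc)
    then show "ennreal ((cmod (?f t))\<^sup>2) \<le> ennreal M * ennreal (exp (- (t\<^sup>2 - pi\<^sup>2) / 4) * (cmod (expsum x J a t))\<^sup>2)"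
      using M by (subst ennreal_mult[symmetric]) (auto intro: ennreal_leI)
  qed
  also have "\<dots> = ennreal M * (\<integral>\<^sup>+t. ennreal (exp (- (t\<^sup>2 - pi\<^sup>2) / 4) * (cmod (expsum x J a t))\<^sup>2) \<partial>lborel)"
    by (rule nn_integral_cmult) measurable
  also have "\<dots> \<le> ennreal M * ennreal (tail_const * (B\<^sup>2 * (fin_norm J a)\<^sup>2))"
    by (intro mult_left_mono Gaussian_weighted_bound[OF J]) simp
  also have "\<dots> = ennreal (M * (tail_const * (B\<^sup>2 * (fin_norm J a)\<^sup>2)))"
    using M tail_const_pos by (subst ennreal_mult) auto
  finally have le: "(\<integral>\<^sup>+t. ennreal ((cmod (?f t))\<^sup>2) \<partial>lborel) \<le> ennreal (M * (tail_const * (B\<^sup>2 * (fin_norm J a)\<^sup>2)))" .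
  have int: "integrable lborel (\<lambda>t. (cmod (?f t))\<^sup>2)"
    by (rule integrableI_bounded) (use le in \<open>auto simp: less_top[symmetric] top_unique\<close>)
  then show "?f \<in> L2 lborel" by (simp add: L2_def)
  have "0 \<le> M * (tail_const * (B\<^sup>2 * (fin_norm J a)\<^sup>2))"
    using M tail_const_pos by simp
  then show "(L2_norm lborel ?f)\<^sup>2 \<le> M * (tail_const * (B\<^sup>2 * (fin_norm J a)\<^sup>2))"
    unfolding L2_norm_power2 using le by (subst (asm) nn_integral_eq_integral[OF int]) auto
qed

lemma weighted_expsum_pairing:
  assumes J: "finite J" "finite J'" and m: "\<omega> \<in> borel_measurable borel"
    and \<omega>: "\<And>t. 0 \<le> \<omega> t" "\<And>t. \<omega> t \<le> M * exp (- (t\<^sup>2 - pi\<^sup>2) / 4)" and M: "M \<ge> 0"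
  shows "integrable lborel (\<lambda>t. complex_of_real (\<omega> t) * (expsum x J a t * cnj (expsum x J' b t)))"
    and "cmod (\<integral>t. complex_of_real (\<omega> t) * (expsum x J a t * cnj (expsum x J' b t)) \<partial>lborel)
      \<le> M * tail_const * B\<^sup>2 * fin_norm J a * fin_norm J' b"
proof -
  let ?f = "\<lambda>J a t. complex_of_real (sqrt (\<omega> t)) * expsum x J a t"
  have eq: "?f J a t * cnj (?f J' b t) = complex_of_real (\<omega> t) * (expsum x J a t * cnj (expsum x J' b t))" for t
  proof -
    have "complex_of_real (sqrt (\<omega> t)) * complex_of_real (sqrt (\<omega> t)) = complex_of_real (\<omega> t)"
      using \<omega>(1) unfolding of_real_mult[symmetric] by simp
    then show ?thesis by (simp add: mult_ac)
  qed
  note f = weighted_expsum_L2(1)[OF J(1) m \<omega> M, of a]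
  note g = weighted_expsum_L2(1)[OF J(2) m \<omega> M, of b]
  show "integrable lborel (\<lambda>t. complex_of_real (\<omega> t) * (expsum x J a t * cnj (expsum x J' b t)))"
    using L2_mult_integrable[OF f L2_cnj[OF g]] unfolding eq .
  have n: "L2_norm lborel (?f J a) \<le> sqrt (M * tail_const) * B * fin_norm J a" if "finite J" for J a
  proof (rule power2_le_imp_le)
    show "(L2_norm lborel (?f J a))\<^sup>2 \<le> (sqrt (M * tail_const) * B * fin_norm J a)\<^sup>2"
      using weighted_expsum_L2(2)[OF that m \<omega> M, of a] M tail_const_pos
      by (simp add: power_mult_distrib mult.assoc)
  qed (use B_pos M tail_const_pos in simp)
  have "cmod (\<integral>t. ?f J a t * cnj (?f J' b t) \<partial>lborel) \<le> L2_norm lborel (?f J a) * L2_norm lborel (?f J' b)"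
    using L2_Cauchy_Schwarz[OF f L2_cnj[OF g]] by (simp only: L2_norm_cnj)
  also have "\<dots> \<le> (sqrt (M * tail_const) * B * fin_norm J a) * (sqrt (M * tail_const) * B * fin_norm J' b)"
    by (intro mult_mono n J) (use B_pos M tail_const_pos in auto)
  also have "\<dots> = (sqrt (M * tail_const))\<^sup>2 * B\<^sup>2 * fin_norm J a * fin_norm J' b"
    by (simp only: power2_eq_square mult_ac)
  also have "(sqrt (M * tail_const))\<^sup>2 = M * tail_const"
    using M tail_const_pos by simp
  finally show "cmod (\<integral>t. complex_of_real (\<omega> t) * (expsum x J a t * cnj (expsum x J' b t)) \<partial>lborel)
      \<le> M * tail_const * B\<^sup>2 * fin_norm J a * fin_norm J' b"
    unfolding eq .
qed

lemma gaussian_kernel_coercive: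
  assumes \<mu>: "0 < \<mu>" "\<mu> \<le> 1"
  shows "coercive_kernel (gaussian_kernel \<mu> x) (freq_weight \<mu> 0 * tail_const * B\<^sup>2) (freq_weight \<mu> pi / B\<^sup>2)"
proof
  note w = freq_weight_measurable less_imp_le[OF freq_weight_pos[OF \<mu>(1)]] freq_weight_le[OF \<mu>]
    less_imp_le[OF freq_weight_pos[OF \<mu>(1)]]
  show "gaussian_kernel \<mu> x k j = gaussian_kernel \<mu> x j k" for k j
    by (simp add: power2_commute)
  show "0 \<le> freq_weight \<mu> 0 * tail_const * B\<^sup>2"
    using freq_weight_pos[OF \<mu>(1), of 0] tail_const_pos by simp
  show "0 < freq_weight \<mu> pi / B\<^sup>2"
    using freq_weight_pos[OF \<mu>(1), of pi] B_pos by simp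
  show "cmod (bilinear_sum (gaussian_kernel \<mu> x) J a J' b)
      \<le> freq_weight \<mu> 0 * tail_const * B\<^sup>2 * fin_norm J a * fin_norm J' b"
    if "finite J" "finite J'" for J J' a b
    unfolding bilinear_sum_gaussian[OF \<mu>(1)] by (rule weighted_expsum_pairing(2)[OF that w])
  fix J a assume J: "finite (J :: int set)"
  let ?p = "\<lambda>u. (cmod (expsum x J a u))\<^sup>2"
  have sq: "complex_of_real (freq_weight \<mu> u) * (expsum x J a u * cnj (expsum x J a u)) =
      complex_of_real (freq_weight \<mu> u * ?p u)" for u
    by (simp flip: complex_norm_square)
  have int: "integrable lborel (\<lambda>u. freq_weight \<mu> u * ?p u)"
    using weighted_expsum_pairing(1)[OF J J w, of a a] unfolding sq by (simp only: complex_of_real_integrable_eq)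
  have "bilinear_sum (gaussian_kernel \<mu> x) J a J a = complex_of_real (\<integral>u. freq_weight \<mu> u * ?p u \<partial>lborel)"
    unfolding bilinear_sum_gaussian[OF \<mu>(1)] sq by (rule integral_complex_of_real)
  then have Re: "Re (bilinear_sum (gaussian_kernel \<mu> x) J a J a) = (\<integral>u. freq_weight \<mu> u * ?p u \<partial>lborel)"
    by simp
  have "(fin_norm J a)\<^sup>2 \<le> B\<^sup>2 * (L2_norm pi_interval (expsum x J a))\<^sup>2"
    using power_mono[OF lower[OF J, of a], of 2] by (simp add: power_mult_distrib)
  then have "freq_weight \<mu> pi / B\<^sup>2 * (fin_norm J a)\<^sup>2 \<le>
      freq_weight \<mu> pi / B\<^sup>2 * (B\<^sup>2 * (L2_norm pi_interval (expsum x J a))\<^sup>2)"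
    using less_imp_le[OF freq_weight_pos[OF \<mu>(1), of pi]] by (intro mult_left_mono) auto
  also have "\<dots> = freq_weight \<mu> pi * (\<integral>u. indicator {-pi..pi} u * ?p u \<partial>lborel)"
    using B_pos by (simp add: L2_norm_power2 pi_interval_integral)
  also have "\<dots> = (\<integral>u. freq_weight \<mu> pi * (indicator {-pi..pi} u * ?p u) \<partial>lborel)"
    by simp
  \<comment> \<open>Inside the interval G is at least G(pi); the contribution from outside is
    nonnegative and is dropped.\<close>
  also have "\<dots> \<le> (\<integral>u. freq_weight \<mu> u * ?p u \<partial>lborel)"
  proof (rule integral_mono[OF _ int])
    show "integrable lborel (\<lambda>u. freq_weight \<mu> pi * (indicator {-pi..pi} u * ?p u))"
      using L2_integrable[OF expsum_L2[OF J, of a]] by (simp add: pi_interval_integrable_iff)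
    show "freq_weight \<mu> pi * (indicator {-pi..pi} u * ?p u) \<le> freq_weight \<mu> u * ?p u" for u
      using freq_weight_antimono[OF \<mu>(1), of u pi] less_imp_le[OF freq_weight_pos[OF \<mu>(1), of u]]
      by (auto simp: indicator_def intro!: mult_right_mono)
  qed
  finally show "freq_weight \<mu> pi / B\<^sup>2 * (fin_norm J a)\<^sup>2 \<le> Re (bilinear_sum (gaussian_kernel \<mu> x) J a J a)"
    unfolding Re .
qed

text \<open>Under the second root, the first summand comes from the frequencies inside [-pi, pi] by
  duality, the second from those outside. The factor \<open>sqrt (4 * pi)\<close> is the cost of
  returning to the time side.\<close>

definition stability_const :: real where
  "stability_const = sqrt (4 * pi) * sqrt ((B * (1 + tail_const * B ^ 4))\<^sup>2 + tail_const * B ^ 6)"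

text \<open>Hypothesis \<open>bd\<close> asks only that the values of the Gaussian sum at the nodes
  have dual norm at most \<open>Y\<close>. This is the form in which \<open>truncation_bound\<close>
  delivers truncations of the exact solution.\<close>

lemma gaussian_sum_stability:
  assumes \<mu>: "0 < \<mu>" "\<mu> \<le> 1" and J: "finite J" and Y: "Y \<ge> 0"
    and bd: "\<And>J' b. finite J' \<Longrightarrow> cmod (bilinear_sum (gaussian_kernel \<mu> x) J a J' b) \<le> Y * fin_norm J' b"
  shows "gaussian_sum \<mu> x J a \<in> L2 lborel"
    and "L2_norm lborel (gaussian_sum \<mu> x J a) \<le> stability_const * Y"
proof -
  let ?G = "freq_weight \<mu>" and ?\<kappa> = tail_const
  interpret K: coercive_kernel "gaussian_kernel \<mu> x" "?G 0 * ?\<kappa> * B\<^sup>2" "?G pi / B\<^sup>2"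
    by (rule gaussian_kernel_coercive[OF \<mu>])
  define n where "n = fin_norm J a"
  have n0: "n \<ge> 0" by (simp add: n_def)
  note Gpos = freq_weight_pos[OF \<mu>(1)]
  \<comment> \<open>Coercivity against \<open>bd\<close> with \<open>b = a\<close>, divided by
    \<open>n\<close>. All dependence on \<mu> in the remaining estimates is absorbed by this
    product.\<close>
  have Gn: "?G pi * n \<le> B\<^sup>2 * Y"
  proof (cases "n = 0")
    case False
    have "?G pi / B\<^sup>2 * n\<^sup>2 \<le> Re (bilinear_sum (gaussian_kernel \<mu> x) J a J a)"
      unfolding n_def by (rule K.coercive[OF J])
    also have "\<dots> \<le> Y * n"
      unfolding n_def by (rule order_trans[OF complex_Re_le_cmod bd[OF J]])
    finally have "(?G pi / B\<^sup>2 * n) * n \<le> Y * n" by (simp add: power2_eq_square mult.assoc)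
    then have "?G pi / B\<^sup>2 * n \<le> Y" by (rule mult_right_le_imp_le) (use False n0 in simp)
    then show ?thesis using B_pos by (simp add: field_simps)
  qed (use Y in simp)
  define out where "out = (\<lambda>u. indicator (- {-pi..pi}) u * ?G u)"
  have out_m [measurable]: "out \<in> borel_measurable borel" unfolding out_def by measurable
  have out0: "0 \<le> out u" for u using less_imp_le[OF Gpos] by (simp add: out_def)
  have out_le: "out u \<le> ?G pi * exp (- (u\<^sup>2 - pi\<^sup>2) / 4)" for u
  proof (cases "u \<in> {-pi..pi}")
    case True
    then show ?thesis using less_imp_le[OF Gpos[of pi]] by (simp add: out_def)
  next
    case False
    then have "pi \<le> \<bar>u\<bar>" by auto
    then show ?thesis using freq_weight_tail[OF \<mu>, of u] False by (simp add: out_def)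
  qed
  note out = out_m out0 out_le less_imp_le[OF Gpos[of pi]]
  note full = freq_weight_measurable less_imp_le[OF Gpos] freq_weight_le[OF \<mu>] less_imp_le[OF Gpos[of 0]]
  define u where "u = (\<lambda>t. complex_of_real (?G t) * expsum x J a t)"
  have uI: "u \<in> L2 pi_interval"
    unfolding u_def
  proof (rule L2_bounded_mult[OF expsum_L2[OF J]])
    show "(\<lambda>t. complex_of_real (?G t)) \<in> borel_measurable pi_interval"
      by (rule measurable_restrict_space1) measurable
    show "cmod (complex_of_real (?G t)) \<le> ?G 0" for t
      using freq_weight_antimono[OF \<mu>(1), of 0 t] less_imp_le[OF Gpos[of t]] by simp
  qed
  \<comment> \<open>The pairing on [-pi, pi] is the whole form minus its outer part. The outer part
    carries the factor G(pi) n, at most B^2 Y, which together with the B^2 of the pairing bound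
    produces the term with B^4.\<close>
  have dual: "cmod (\<integral>t. u t * cnj (expsum x J' b t) \<partial>pi_interval) \<le> (1 + ?\<kappa> * B ^ 4) * Y * fin_norm J' b"
    if J': "finite J'" for J' b
  proof -
    let ?e = "\<lambda>t. expsum x J a t * cnj (expsum x J' b t)"
    have split: "indicator {-pi..pi} t *\<^sub>R (u t * cnj (expsum x J' b t)) =
        complex_of_real (?G t) * ?e t - complex_of_real (out t) * ?e t" for t
      by (auto simp: u_def out_def indicator_def)
    have "(\<integral>t. u t * cnj (expsum x J' b t) \<partial>pi_interval) =
        bilinear_sum (gaussian_kernel \<mu> x) J a J' b - (\<integral>t. complex_of_real (out t) * ?e t \<partial>lborel)"
      unfolding pi_interval_integral split bilinear_sum_gaussian[OF \<mu>(1)]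
      by (rule Bochner_Integration.integral_diff[OF weighted_expsum_pairing(1)[OF J J' full] weighted_expsum_pairing(1)[OF J J' out]])
    then have "cmod (\<integral>t. u t * cnj (expsum x J' b t) \<partial>pi_interval) \<le>
        Y * fin_norm J' b + ?G pi * ?\<kappa> * B\<^sup>2 * n * fin_norm J' b"
      using norm_triangle_ineq4[of "bilinear_sum (gaussian_kernel \<mu> x) J a J' b" "\<integral>t. complex_of_real (out t) * ?e t \<partial>lborel"]
        bd[OF J', of b] weighted_expsum_pairing(2)[OF J J' out, of a b] unfolding n_def by simp
    also have "?G pi * ?\<kappa> * B\<^sup>2 * n * fin_norm J' b = (?\<kappa> * B\<^sup>2 * fin_norm J' b) * (?G pi * n)"
      by (simp add: mult_ac)
    also have "\<dots> \<le> (?\<kappa> * B\<^sup>2 * fin_norm J' b) * (B\<^sup>2 * Y)"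
      using Gn tail_const_pos by (intro mult_left_mono) auto
    also have "Y * fin_norm J' b + (?\<kappa> * B\<^sup>2 * fin_norm J' b) * (B\<^sup>2 * Y) = (1 + ?\<kappa> * B ^ 4) * Y * fin_norm J' b"
      by (simp add: algebra_simps power2_eq_square power4_eq_xxxx)
    finally show ?thesis by simp
  qed
  have D0: "0 \<le> (1 + ?\<kappa> * B ^ 4) * Y" using Y tail_const_pos B_pos by simp
  have inner: "(L2_norm pi_interval u)\<^sup>2 \<le> (B * ((1 + ?\<kappa> * B ^ 4) * Y))\<^sup>2"
    by (intro power_mono norm_le_dual_bound[OF uI D0 dual]) auto
  \<comment> \<open>Outside the interval G^2 \<le> G(pi) G, so this weight dominates the squared one
    there. Its Gaussian majorant has the constant G(pi)^2, which again combines with n^2 into the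
    square of the bounded product.\<close>
  let ?\<omega> = "\<lambda>t. ?G pi * out t"
  have out2_le: "?\<omega> t \<le> (?G pi)\<^sup>2 * exp (- (t\<^sup>2 - pi\<^sup>2) / 4)" for t
    using mult_left_mono[OF out_le, of "?G pi" t] less_imp_le[OF Gpos[of pi]]
    by (simp add: power2_eq_square mult.assoc)
  have out2_0: "0 \<le> ?\<omega> t" for t using out0 less_imp_le[OF Gpos[of pi]] by simp
  have out2_m: "?\<omega> \<in> borel_measurable borel" by measurable
  note outer = weighted_expsum_L2[OF J out2_m out2_0 out2_le, of a]
  have outer_int: "integrable lborel (\<lambda>t. ?\<omega> t * (cmod (expsum x J a t))\<^sup>2)"
    using L2_integrable[OF outer(1)] out2_0 by (simp add: norm_mult power_mult_distrib)
  have outer_le: "(\<integral>t. ?\<omega> t * (cmod (expsum x J a t))\<^sup>2 \<partial>lborel) \<le> ?\<kappa> * B ^ 6 * Y\<^sup>2"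
  proof -
    have "(\<integral>t. ?\<omega> t * (cmod (expsum x J a t))\<^sup>2 \<partial>lborel) \<le> (?G pi)\<^sup>2 * (?\<kappa> * (B\<^sup>2 * n\<^sup>2))"
      using outer(2) out2_0 unfolding n_def L2_norm_power2 by (simp add: norm_mult power_mult_distrib)
    also have "\<dots> = ?\<kappa> * B\<^sup>2 * (?G pi * n)\<^sup>2" by (simp add: power_mult_distrib mult_ac)
    also have "\<dots> \<le> ?\<kappa> * B\<^sup>2 * (B\<^sup>2 * Y)\<^sup>2"
      using Gn n0 less_imp_le[OF Gpos[of pi]] tail_const_pos by (intro mult_left_mono power_mono) auto
    also have "\<dots> = ?\<kappa> * B ^ 6 * Y\<^sup>2" by (simp add: power_mult_distrib flip: power_mult power_add)
    finally show ?thesis .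
  qed
  have inner_int: "integrable lborel (\<lambda>t. indicator {-pi..pi} t * (cmod (u t))\<^sup>2)"
    using L2_integrable[OF uI] by (simp add: pi_interval_integrable_iff)
  have le: "(cmod (u t))\<^sup>2 \<le> indicator {-pi..pi} t * (cmod (u t))\<^sup>2 + ?\<omega> t * (cmod (expsum x J a t))\<^sup>2" for t
  proof (cases "t \<in> {-pi..pi}")
    case False
    then have "\<bar>pi\<bar> \<le> \<bar>t\<bar>" by auto
    then have "?G t * ?G t \<le> ?G pi * ?G t"
      using freq_weight_antimono[OF \<mu>(1)] less_imp_le[OF Gpos[of t]] by (intro mult_right_mono) auto
    then have "(?G t * ?G t) * (cmod (expsum x J a t))\<^sup>2 \<le> (?G pi * ?G t) * (cmod (expsum x J a t))\<^sup>2"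
      by (rule mult_right_mono) simp
    then show ?thesis using False
      by (simp add: u_def out_def norm_mult power_mult_distrib power2_eq_square[of "?G t"])
  qed (use out2_0 in simp)
  have um [measurable]: "u \<in> borel_measurable borel" unfolding u_def by measurable
  have uint: "integrable lborel (\<lambda>t. (cmod (u t))\<^sup>2)"
    by (rule Bochner_Integration.integrable_bound[OF Bochner_Integration.integrable_add[OF inner_int outer_int]])
      (use le in \<open>auto intro: order_trans[OF _ abs_ge_self]\<close>)
  then have uL: "u \<in> L2 lborel" by (simp add: L2_def)
  have "(L2_norm lborel u)\<^sup>2 \<le> (\<integral>t. indicator {-pi..pi} t * (cmod (u t))\<^sup>2 + ?\<omega> t * (cmod (expsum x J a t))\<^sup>2 \<partial>lborel)"
    unfolding L2_norm_power2
    by (rule integral_mono[OF uint Bochner_Integration.integrable_add[OF inner_int outer_int] le])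
  also have "\<dots> = (\<integral>t. indicator {-pi..pi} t * (cmod (u t))\<^sup>2 \<partial>lborel) + (\<integral>t. ?\<omega> t * (cmod (expsum x J a t))\<^sup>2 \<partial>lborel)"
    by (rule Bochner_Integration.integral_add[OF inner_int outer_int])
  also have "(\<integral>t. indicator {-pi..pi} t * (cmod (u t))\<^sup>2 \<partial>lborel) = (L2_norm pi_interval u)\<^sup>2"
    by (simp add: L2_norm_power2 pi_interval_integral)
  also have "(L2_norm pi_interval u)\<^sup>2 + (\<integral>t. ?\<omega> t * (cmod (expsum x J a t))\<^sup>2 \<partial>lborel)
      \<le> (B * ((1 + ?\<kappa> * B ^ 4) * Y))\<^sup>2 + ?\<kappa> * B ^ 6 * Y\<^sup>2"
    by (rule add_mono[OF inner outer_le])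
  also have "\<dots> = ((B * (1 + ?\<kappa> * B ^ 4))\<^sup>2 + ?\<kappa> * B ^ 6) * Y\<^sup>2"
    by (simp only: power_mult_distrib[of B] power_mult_distrib[of "1 + _" Y] distrib_right[of _ _ "Y\<^sup>2"] mult.assoc)
  finally have "L2_norm lborel u \<le> sqrt (((B * (1 + ?\<kappa> * B ^ 4))\<^sup>2 + ?\<kappa> * B ^ 6) * Y\<^sup>2)"
    by (rule real_le_rsqrt)
  then have ub: "L2_norm lborel u \<le> sqrt ((B * (1 + ?\<kappa> * B ^ 4))\<^sup>2 + ?\<kappa> * B ^ 6) * Y"
    using Y by (simp add: real_sqrt_mult)
  show "gaussian_sum \<mu> x J a \<in> L2 lborel"
    by (rule gaussian_sum_L2_norm(1)[OF \<mu>(1) uL[unfolded u_def]])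
  have "L2_norm lborel (gaussian_sum \<mu> x J a) \<le> sqrt (4 * pi) * L2_norm lborel u"
    unfolding u_def by (rule gaussian_sum_L2_norm(2)[OF \<mu>(1) uL[unfolded u_def]])
  also have "\<dots> \<le> sqrt (4 * pi) * (sqrt ((B * (1 + ?\<kappa> * B ^ 4))\<^sup>2 + ?\<kappa> * B ^ 6) * Y)"
    by (rule mult_left_mono[OF ub]) simp
  finally show "L2_norm lborel (gaussian_sum \<mu> x J a) \<le> stability_const * Y"
    by (simp add: stability_const_def mult.assoc)
qed

end

section \<open>The interpolation operator\<close>

context riesz_exponentials
begin

text \<open>A Bessel inequality dual to the upper Riesz bound. Inserting the inversion formula, 2 pi
  times the squared norm of the samples \<open>y\<close> is the pairing of \<open>h\<close> with the
  exponential sum of \<open>y\<close>. Cauchy--Schwarz and the upper bound leave one factor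
  \<open>fin_norm J y\<close>, which is cancelled.\<close>

lemma PW_pi_samples_bound:
  assumes f: "f \<in> PW_pi" and J: "finite J"
  shows "fin_norm J (\<lambda>k. f (x k)) \<le> B / (2 * pi) * sqrt (4 * pi) * norm_R f"
proof -
  obtain h where h: "h \<in> L2 lborel" and hn: "L2_norm lborel h \<le> sqrt (4 * pi) * L2_norm lborel f"
    and h0: "\<And>t. t \<notin> {-pi..pi} \<Longrightarrow> h t = 0"
    and inv: "\<And>t. complex_of_real (2 * pi) * f t = (\<integral>u. h u * exp (\<i> * complex_of_real (u * t)) \<partial>lborel)"
    using PW_pi_representation[OF f] by blast
  note [measurable] = L2_measurable[OF h]
  have ind: "indicator {-pi..pi} u *\<^sub>R (h u * z) = h u * z" for u z
    using h0 by (auto simp: indicator_def)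
  have sq: "indicator {-pi..pi} u *\<^sub>R (cmod (h u))\<^sup>2 = (cmod (h u))\<^sup>2" for u
    using h0 by (auto simp: indicator_def)
  have hI: "h \<in> L2 pi_interval"
    unfolding L2_def mem_Collect_eq pi_interval_integrable_iff sq
    using L2_integrable[OF h] by (auto intro: measurable_restrict_space1)
  have hIn: "L2_norm pi_interval h = L2_norm lborel h"
    unfolding L2_norm_def pi_interval_integral sq ..
  define y where "y = (\<lambda>k. f (x k))"
  note E = L2_cnj[OF expsum_L2[OF J, of y]]
  have wave: "integrable lborel (\<lambda>u. h u * exp (\<i> * complex_of_real (u * t)))" for t
  proof (rule Bochner_Integration.integrable_bound)
    show "integrable lborel (\<lambda>u. complex_of_real (indicator {-pi..pi} u) * h u)"
      by (intro L2_mult_integrable indicator_L2 h) auto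
    show "AE u in lborel. norm (h u * exp (\<i> * complex_of_real (u * t))) \<le> norm (complex_of_real (indicator {-pi..pi} u) * h u)"
      using h0 by (intro AE_I2) (auto simp: norm_mult indicator_def)
  qed measurable
  have "complex_of_real (2 * pi * (fin_norm J y)\<^sup>2) = (\<Sum>k\<in>J. (complex_of_real (2 * pi) * f (x k)) * cnj (y k))"
    unfolding fin_norm_power2 y_def of_real_mult of_real_sum complex_norm_square
    by (simp add: sum_distrib_left mult.assoc)
  also have "\<dots> = (\<integral>u. (\<Sum>k\<in>J. (h u * exp (\<i> * complex_of_real (u * x k))) * cnj (y k)) \<partial>lborel)"
    unfolding inv using wave by (subst Bochner_Integration.integral_sum) auto
  also have "\<dots> = (\<integral>u. h u * cnj (expsum x J y u) \<partial>pi_interval)"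
    unfolding pi_interval_integral ind cnj_expsum by (simp only: sum_distrib_left mult_ac)
  finally have eq: "complex_of_real (2 * pi * (fin_norm J y)\<^sup>2) = (\<integral>u. h u * cnj (expsum x J y u) \<partial>pi_interval)" .
  have "2 * pi * (fin_norm J y)\<^sup>2 = cmod (complex_of_real (2 * pi * (fin_norm J y)\<^sup>2))"
    unfolding norm_of_real by simp
  also have "\<dots> \<le> L2_norm pi_interval h * L2_norm pi_interval (expsum x J y)"
    unfolding eq using L2_Cauchy_Schwarz[OF hI E] by (simp only: L2_norm_cnj)
  also have "\<dots> \<le> (sqrt (4 * pi) * norm_R f) * (B * fin_norm J y)"
    unfolding hIn by (intro mult_mono hn upper J) auto
  finally have le: "(2 * pi * fin_norm J y) * fin_norm J y \<le> (B * sqrt (4 * pi) * norm_R f) * fin_norm J y"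
    by (simp only: power2_eq_square mult_ac)
  have "2 * pi * fin_norm J y \<le> B * sqrt (4 * pi) * norm_R f"
  proof (cases "fin_norm J y = 0")
    case True
    then show ?thesis using B_pos by simp
  next
    case False
    then have "fin_norm J y > 0" by (metis L2_set_nonneg less_eq_real_def)
    then show ?thesis by (rule mult_right_le_imp_le[OF le])
  qed
  then have "fin_norm J y \<le> B / (2 * pi) * sqrt (4 * pi) * norm_R f" by (simp add: field_simps)
  then show ?thesis by (simp add: y_def)
qed

lemma interpolation_coeffs_solution:
  assumes \<mu>: "0 < \<mu>" "\<mu> \<le> 1" and f: "f \<in> PW_pi"
  shows "square_summable (interpolation_coeffs x \<mu> f) \<and>
    (\<forall>k. ((\<lambda>j. interpolation_coeffs x \<mu> f j * complex_of_real (gaussian_kernel \<mu> x k j)) has_sum f (x k)) UNIV)"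
proof -
  interpret K: coercive_kernel "gaussian_kernel \<mu> x" "freq_weight \<mu> 0 * tail_const * B\<^sup>2" "freq_weight \<mu> pi / B\<^sup>2"
    by (rule gaussian_kernel_coercive[OF \<mu>])
  have "\<exists>!a. square_summable a \<and>
      (\<forall>k. ((\<lambda>j. a j * complex_of_real (gaussian_kernel \<mu> x k j)) has_sum f (x k)) UNIV)"
    using K.solution_exists[OF PW_pi_samples_bound[OF f]] K.solution_unique[where y="\<lambda>k. f (x k)"]
    by (intro ex_ex1I) auto
  then show ?thesis unfolding interpolation_coeffs_def by (rule theI')
qed

text \<open>The weight is split evenly between the wave at \<open>t\<close> and the exponential sum.
  The first factor has norm 1 because G is a probability density, so the bound is independent of
  \<open>t\<close>. For fixed \<mu> this yields convergence of the interpolation series at every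
  point.\<close>

lemma gaussian_sum_pointwise_bound:
  assumes \<mu>: "0 < \<mu>" "\<mu> \<le> 1" and J: "finite J"
  shows "cmod (gaussian_sum \<mu> x J a t) \<le> sqrt (freq_weight \<mu> 0 * (tail_const * B\<^sup>2)) * fin_norm J a"
proof -
  let ?G = "freq_weight \<mu>"
  note Gpos = freq_weight_pos[OF \<mu>(1)]
  note full = freq_weight_measurable less_imp_le[OF Gpos] freq_weight_le[OF \<mu>] less_imp_le[OF Gpos[of 0]]
  define v where "v = (\<lambda>u. complex_of_real (sqrt (?G u)) * exp (\<i> * complex_of_real (u * t)))"
  define w where "w = (\<lambda>u. complex_of_real (sqrt (?G u)) * expsum x J a u)"
  have Gint: "has_bochner_integral lborel ?G 1"
    using has_bochner_integral_bounded_linear[OF bounded_linear_Re freq_weight_fourier[OF \<mu>(1), of 0]] by simp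
  have vsq: "(cmod (v u))\<^sup>2 = ?G u" for u
    using less_imp_le[OF Gpos] by (simp add: v_def norm_mult)
  have [measurable]: "v \<in> borel_measurable borel" unfolding v_def by measurable
  have v: "v \<in> L2 lborel" "L2_norm lborel v = 1"
    using Gint unfolding L2_def L2_norm_def by (auto simp: vsq has_bochner_integral_iff)
  have w: "w \<in> L2 lborel" "(L2_norm lborel w)\<^sup>2 \<le> ?G 0 * (tail_const * (B\<^sup>2 * (fin_norm J a)\<^sup>2))"
    unfolding w_def by (rule weighted_expsum_L2[OF J full])+
  have "v u * w u = complex_of_real (?G u) * expsum x J a u * exp (\<i> * complex_of_real (u * t))" for u
  proof -
    have "complex_of_real (sqrt (?G u)) * complex_of_real (sqrt (?G u)) = complex_of_real (?G u)"
      using less_imp_le[OF Gpos[of u]] unfolding of_real_mult[symmetric] by simp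
    then show ?thesis unfolding v_def w_def by (simp add: mult_ac)
  qed
  then have "gaussian_sum \<mu> x J a t = (\<integral>u. v u * w u \<partial>lborel)"
    using has_bochner_integral_integral_eq[OF gaussian_sum_fourier[OF \<mu>(1), of x J a t]] by simp
  then have "cmod (gaussian_sum \<mu> x J a t) \<le> L2_norm lborel w"
    using L2_Cauchy_Schwarz[OF v(1) w(1)] v(2) by simp
  also have "\<dots> \<le> sqrt (?G 0 * (tail_const * (B\<^sup>2 * (fin_norm J a)\<^sup>2)))"
    by (rule real_le_rsqrt[OF w(2)])
  also have "?G 0 * (tail_const * (B\<^sup>2 * (fin_norm J a)\<^sup>2)) = (?G 0 * (tail_const * B\<^sup>2)) * (fin_norm J a)\<^sup>2"
    by (simp only: mult_ac)
  also have "sqrt \<dots> = sqrt (?G 0 * (tail_const * B\<^sup>2)) * fin_norm J a"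
    by (subst real_sqrt_mult) simp
  finally show ?thesis .
qed

lemma gaussian_series_summable:
  assumes \<mu>: "0 < \<mu>" "\<mu> \<le> 1" and a: "square_summable a"
  shows "(\<lambda>j. a j * complex_of_real (exp (- \<mu> * (t - x j)\<^sup>2))) summable_on UNIV"
proof (rule abs_summable_summable, rule nonneg_bdd_above_summable_on)
  let ?f = "\<lambda>j. cmod (a j * complex_of_real (exp (- \<mu> * (t - x j)\<^sup>2)))"
  define R where "R = sqrt (freq_weight \<mu> 0 * (tail_const * B\<^sup>2))"
  have R0: "R \<ge> 0" using freq_weight_pos[OF \<mu>(1), of 0] tail_const_pos by (simp add: R_def)
  show "bdd_above (sum ?f ` {F. F \<subseteq> UNIV \<and> finite F})"
  proof (rule bdd_aboveI2)
    fix F assume "F \<in> {F :: int set. F \<subseteq> UNIV \<and> finite F}"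
    then have F: "finite F" by simp
    \<comment> \<open>Replacing the coefficients by their moduli turns the sum of absolute values
      into a Gaussian sum of the same coefficient norm.\<close>
    define s where "s = (\<lambda>j. complex_of_real (cmod (a j)))"
    have "sum ?f F = cmod (complex_of_real (sum ?f F))"
      unfolding norm_of_real by (simp add: sum_nonneg)
    also have "complex_of_real (sum ?f F) = gaussian_sum \<mu> x F s t"
      by (simp add: gaussian_sum_def s_def norm_mult)
    also have "cmod \<dots> \<le> R * fin_norm F s"
      unfolding R_def by (rule gaussian_sum_pointwise_bound[OF \<mu> F])
    also have "\<dots> \<le> R * l2_norm a"
      using square_summable_bound[OF a F] R0 by (intro mult_left_mono) (auto simp: s_def)
    finally show "sum ?f F \<le> R * l2_norm a" .
  qed
qed auto

text \<open>Truncations beyond \<open>J0\<close> satisfy the stability hypothesis with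
  \<open>Y + e\<close> and converge pointwise to the interpolant. Fatou's lemma transfers their
  common L2 bound, and then \<open>e\<close> tends to 0.\<close>

lemma gaussian_interpolation_bound:
  assumes \<mu>: "0 < \<mu>" "\<mu> \<le> 1" and f: "f \<in> PW_pi"
  shows "gaussian_interpolation x \<mu> f \<in> L2_R"
    and "norm_R (gaussian_interpolation x \<mu> f) \<le> stability_const * (B / (2 * pi) * sqrt (4 * pi)) * norm_R f"
proof -
  interpret K: coercive_kernel "gaussian_kernel \<mu> x" "freq_weight \<mu> 0 * tail_const * B\<^sup>2" "freq_weight \<mu> pi / B\<^sup>2"
    by (rule gaussian_kernel_coercive[OF \<mu>])
  define a where "a = interpolation_coeffs x \<mu> f"
  define S where "S = gaussian_interpolation x \<mu> f"
  define Y where "Y = B / (2 * pi) * sqrt (4 * pi) * norm_R f"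
  have Y0: "Y \<ge> 0" using B_pos by (simp add: Y_def)
  have C0: "stability_const \<ge> 0"
    using tail_const_pos B_pos by (simp add: stability_const_def)
  have y: "fin_norm J (\<lambda>k. f (x k)) \<le> Y" if "finite J" for J
    unfolding Y_def by (rule PW_pi_samples_bound[OF f that])
  have a: "square_summable a"
    and sol: "\<And>k. ((\<lambda>j. a j * complex_of_real (gaussian_kernel \<mu> x k j)) has_sum f (x k)) UNIV"
    using interpolation_coeffs_solution[OF \<mu> f] by (auto simp: a_def)
  have S: "((\<lambda>J. gaussian_sum \<mu> x J a t) \<longlongrightarrow> S t) (finite_subsets_at_top UNIV)" for t
    using has_sum_infsum[OF gaussian_series_summable[OF \<mu> a, of t]]
    by (simp add: has_sum_def gaussian_sum_def S_def gaussian_interpolation_def a_def)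
  have approx: "S \<in> L2 lborel \<and> L2_norm lborel S \<le> stability_const * (Y + e)" if e: "e > 0" for e
  proof -
    obtain J0 where J0: "finite J0" "\<And>J J' b. finite J \<Longrightarrow> J0 \<subseteq> J \<Longrightarrow> finite J' \<Longrightarrow>
        cmod (bilinear_sum (gaussian_kernel \<mu> x) J a J' b) \<le> (Y + e) * fin_norm J' b"
      by (rule K.truncation_bound[OF a sol y e]) (assumption, rule that)
    \<comment> \<open>Fatou's lemma requires a sequence, so the net of finite index sets is replaced
      by a cofinal sequence that always contains \<open>J0\<close>.\<close>
    define I where "I = (\<lambda>n :: nat. {- int n..int n} \<union> J0)"
    have I: "finite (I n)" "J0 \<subseteq> I n" for n using J0(1) by (auto simp: I_def)
    have "filterlim I (finite_subsets_at_top UNIV) sequentially"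
      unfolding filterlim_finite_subsets_at_top
    proof (intro allI impI)
      fix X :: "int set" assume X: "finite X \<and> X \<subseteq> UNIV"
      then obtain m where m: "\<And>j. j \<in> X \<Longrightarrow> \<bar>j\<bar> \<le> m"
        using bdd_above_finite[of "abs ` X"] by (auto simp: bdd_above_def)
      show "\<forall>\<^sub>F n in sequentially. finite (I n) \<and> X \<subseteq> I n \<and> I n \<subseteq> UNIV"
        using eventually_ge_at_top[of "nat m"]
      proof eventually_elim
        case (elim n)
        have "X \<subseteq> I n" using m elim by (force simp: I_def)
        then show ?case using I by simp
      qed
    qed
    then have lim: "(\<lambda>n. gaussian_sum \<mu> x (I n) a t) \<longlonglongrightarrow> S t" for t
      by (rule filterlim_compose[OF S])
    have g: "gaussian_sum \<mu> x (I n) a \<in> L2 lborel"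
      "L2_norm lborel (gaussian_sum \<mu> x (I n) a) \<le> stability_const * (Y + e)" for n
      using gaussian_sum_stability[OF \<mu> I(1)[of n] _ J0(2)[OF I[of n]]] Y0 e by auto
    note [measurable] = L2_measurable[OF g(1)]
    have [measurable]: "S \<in> borel_measurable lborel"
      by (rule borel_measurable_LIMSEQ_metric[OF L2_measurable[OF g(1)] lim])
    have liminf: "liminf (\<lambda>n. ennreal ((cmod (gaussian_sum \<mu> x (I n) a t))\<^sup>2)) = ennreal ((cmod (S t))\<^sup>2)" for t
      by (rule lim_imp_Liminf) (auto intro!: tendsto_intros tendsto_ennrealI lim)
    have "(\<integral>\<^sup>+t. ennreal ((cmod (S t))\<^sup>2) \<partial>lborel) =
        (\<integral>\<^sup>+t. liminf (\<lambda>n. ennreal ((cmod (gaussian_sum \<mu> x (I n) a t))\<^sup>2)) \<partial>lborel)"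
      by (simp only: liminf)
    also have "\<dots> \<le> liminf (\<lambda>n. \<integral>\<^sup>+t. ennreal ((cmod (gaussian_sum \<mu> x (I n) a t))\<^sup>2) \<partial>lborel)"
      by (rule nn_integral_liminf) measurable
    also have "\<dots> \<le> ennreal ((stability_const * (Y + e))\<^sup>2)"
    proof (intro Liminf_le always_eventually allI)
      fix n
      have "(\<integral>\<^sup>+t. ennreal ((cmod (gaussian_sum \<mu> x (I n) a t))\<^sup>2) \<partial>lborel) =
          ennreal ((L2_norm lborel (gaussian_sum \<mu> x (I n) a))\<^sup>2)"
        unfolding L2_norm_power2 by (rule nn_integral_eq_integral[OF L2_integrable[OF g(1)]]) simp
      also have "\<dots> \<le> ennreal ((stability_const * (Y + e))\<^sup>2)"
        by (intro ennreal_leI power_mono g(2)) simp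
      finally show "(\<integral>\<^sup>+t. ennreal ((cmod (gaussian_sum \<mu> x (I n) a t))\<^sup>2) \<partial>lborel)
          \<le> ennreal ((stability_const * (Y + e))\<^sup>2)" .
    qed simp
    finally have le: "(\<integral>\<^sup>+t. ennreal ((cmod (S t))\<^sup>2) \<partial>lborel) \<le> ennreal ((stability_const * (Y + e))\<^sup>2)" .
    have int: "integrable lborel (\<lambda>t. (cmod (S t))\<^sup>2)"
      by (rule integrableI_bounded) (use le in \<open>auto simp: less_top[symmetric] top_unique\<close>)
    have "(\<integral>t. (cmod (S t))\<^sup>2 \<partial>lborel) \<le> (stability_const * (Y + e))\<^sup>2"
      using le by (subst (asm) nn_integral_eq_integral[OF int]) auto
    then have "L2_norm lborel S \<le> stability_const * (Y + e)"
      unfolding L2_norm_def using C0 Y0 e by (intro real_le_lsqrt) auto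
    then show ?thesis using int by (simp add: L2_def)
  qed
  show "gaussian_interpolation x \<mu> f \<in> L2_R" using approx[of 1] by (simp add: S_def)
  have "(\<lambda>n. stability_const * (Y + inverse (real (Suc n)))) \<longlonglongrightarrow> stability_const * (Y + 0)"
    by (intro tendsto_intros LIMSEQ_inverse_real_of_nat)
  then have "L2_norm lborel S \<le> stability_const * (Y + 0)"
    by (rule LIMSEQ_le_const) (use approx in \<open>auto simp del: of_nat_Suc\<close>)
  then show "norm_R (gaussian_interpolation x \<mu> f) \<le> stability_const * (B / (2 * pi) * sqrt (4 * pi)) * norm_R f"
    by (simp add: S_def Y_def mult.assoc)
qed

text \<open>The combined coefficients are square-summable and solve the equations for the combined
  samples. Uniqueness identifies them as the interpolation coefficients, so linearity holds at every
  point.\<close>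

lemma gaussian_interpolation_linear:
  assumes \<mu>: "0 < \<mu>" "\<mu> \<le> 1" and f: "f \<in> PW_pi" and g: "g \<in> PW_pi"
  shows "gaussian_interpolation x \<mu> (\<lambda>t. \<alpha> * f t + \<beta> * g t) t =
    \<alpha> * gaussian_interpolation x \<mu> f t + \<beta> * gaussian_interpolation x \<mu> g t"
proof -
  interpret K: coercive_kernel "gaussian_kernel \<mu> x" "freq_weight \<mu> 0 * tail_const * B\<^sup>2" "freq_weight \<mu> pi / B\<^sup>2"
    by (rule gaussian_kernel_coercive[OF \<mu>])
  define a where "a = interpolation_coeffs x \<mu> f"
  define b where "b = interpolation_coeffs x \<mu> g"
  have a: "square_summable a"
    and a_sol: "\<And>k. ((\<lambda>j. a j * complex_of_real (gaussian_kernel \<mu> x k j)) has_sum f (x k)) UNIV"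
    using interpolation_coeffs_solution[OF \<mu> f] by (auto simp: a_def)
  have b: "square_summable b"
    and b_sol: "\<And>k. ((\<lambda>j. b j * complex_of_real (gaussian_kernel \<mu> x k j)) has_sum g (x k)) UNIV"
    using interpolation_coeffs_solution[OF \<mu> g] by (auto simp: b_def)
  have c: "square_summable (\<lambda>j. \<alpha> * a j + \<beta> * b j)"
    by (intro square_summable_add square_summable_scale a b)
  have lin: "((\<lambda>j. (\<alpha> * a j + \<beta> * b j) * w j) has_sum \<alpha> * r + \<beta> * s) UNIV"
    if "((\<lambda>j. a j * w j) has_sum r) UNIV" "((\<lambda>j. b j * w j) has_sum s) UNIV" for w :: "int \<Rightarrow> complex" and r s
    using has_sum_add[OF has_sum_cmult_right[OF that(1), of \<alpha>] has_sum_cmult_right[OF that(2), of \<beta>]]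
    by (simp add: distrib_right mult.assoc)
  have "interpolation_coeffs x \<mu> (\<lambda>t. \<alpha> * f t + \<beta> * g t) = (\<lambda>j. \<alpha> * a j + \<beta> * b j)"
    unfolding interpolation_coeffs_def
  proof (rule the_equality)
    fix d assume d: "square_summable d \<and> (\<forall>k. ((\<lambda>j. d j * complex_of_real (gaussian_kernel \<mu> x k j))
        has_sum \<alpha> * f (x k) + \<beta> * g (x k)) UNIV)"
    show "d = (\<lambda>j. \<alpha> * a j + \<beta> * b j)"
      by (rule K.solution_unique[OF _ _ c lin[OF a_sol b_sol]]) (use d in auto)
  qed (use c lin[OF a_sol b_sol] in auto)
  then show ?thesis
    unfolding gaussian_interpolation_def a_def[symmetric] b_def[symmetric]
    using lin[OF has_sum_infsum[OF gaussian_series_summable[OF \<mu> a, of t]]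
        has_sum_infsum[OF gaussian_series_summable[OF \<mu> b, of t]]]
    by (simp add: infsumI)
qed

end

theorem theorem3p9:
  fixes x :: "int \<Rightarrow> real"
  assumes "riesz_basis_sequence x"
  shows "(\<forall>\<mu>\<in>{0<..1}. linear_operator_into_L2 PW_pi (gaussian_interpolation x \<mu>)) \<and>
         (\<exists>C. \<forall>\<mu>\<in>{0<..1}. \<forall>f\<in>PW_pi. norm_R (gaussian_interpolation x \<mu> f) \<le> C * norm_R f)"
proof -
  obtain B where "riesz_exponentials x B"
    using riesz_basis_sequence_exponentials[OF assms] .
  then interpret riesz_exponentials x B .
  show ?thesis
    unfolding linear_operator_into_L2_def
    by (auto intro!: gaussian_interpolation_bound(1) exI[of _ "stability_const * (B / (2 * pi) * sqrt (4 * pi))"]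
        gaussian_interpolation_bound(2) simp: gaussian_interpolation_linear)
qed

end
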